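(* Let $\mathcal X$ be an RD-space and let $\rho$ be an admissible function on $\mathcal X$. For $g\in L^1_{\rm loc}(\mathcal X)$ and $x\in\mathcal X$ let $M_\rho(g)(x)=\sup_{x\in B,\,B\notin\mathcal D}g_B$, the supremum being over all balls $B$ containing $x$ and not belonging to the collection $\mathcal D$ of balls $B(z,r)$ with $r\ge\rho(z)$. Then $f\in\mathrm{BLO}_\rho(\mathcal X)$ if and only if there exist $h\in L^\infty(\mathcal X)$ and $g\in\mathrm{BMO}_\rho(\mathcal X)$ such that $$f=M_\rho(g)+h.$$ Furthermore, there is a constant $C\ge1$ such that for all $f\in\mathrm{BLO}_\rho(\mathcal X)$, $$C^{-1}\|f\|_{\mathrm{BLO}_\rho(\mathcal X)}\le\inf\left(\|g\|_{\mathrm{BMO}_\rho(\mathcal X)}+\|h\|_{L^\infty(\mathcal X)}\right)\le C\|f\|_{\mathrm{BLO}_\rho(\mathcal X)},$$ where the infimum is taken over all representations $f=M_\rho(g)+h$ with $g\in\mathrm{BMO}_\rho(\mathcal X)$ and $h\in L^\infty(\mathcal X)$.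
   Context: RD-space: $(\mathcal X,d)$ is a metric space with a regular Borel measure $\mu$ such that all balls $B(x,r)=\{y: d(x,y)<r\}$ have finite and positive measure; $\mu$ is doubling, i.e. there is $A_1\ge1$ with $\mu(B(x,2r))\le A_1\mu(B(x,r))$ for all $x\in\mathcal X$, $r>0$; and there are $0<\kappa\le n$, $A_2\in(0,1]$, $A_3\in[1,\infty)$ such that $A_2\lambda^\kappa\mu(B(x,r))\le\mu(B(x,\lambda r))\le A_3\lambda^n\mu(B(x,r))$ for all $x\in\mathcal X$, $0<r\le \mathrm{diam}(\mathcal X)/2$ and $1\le\lambda\le \mathrm{diam}(\mathcal X)/(2r)$. Balls are understood together with their center and radius. Admissible function: $\rho:\mathcal X\to(0,\infty)$ is admissible if there are positive constants $C_0,k_0$ such that $\frac1{\rho(x)}\le C_0\frac1{\rho(y)}\left(1+\frac{d(x,y)}{\rho(y)}\right)^{k_0}$ for all $x,y\in\mathcal X$. Functions here are real-valued, identified when equal almost everywhere; $L^1_{\rm loc}(\mathcal X)$ means integrable on every ball; $f_B=\frac1{\mu(B)}\int_B f\,d\mu$. With $\mathcal D$ the collection of balls $B(x,r)$ with $r\ge\rho(x)$, the spaces consist of the $f\in L^1_{\rm loc}(\mathcal X)$ for which the following are finite: $$\|f\|_{\mathrm{BMO}_\rho(\mathcal X)}=\sup_{B\notin\mathcal D}\frac1{\mu(B)}\int_B|f-f_B|\,d\mu+\sup_{B\in\mathcal D}\frac1{\mu(B)}\int_B|f|\,d\mu,$$ $$\|f\|_{\mathrm{BLO}_\rho(\mathcal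 X)}=\sup_{B\notin\mathcal D}\frac1{\mu(B)}\int_B\left[f-\operatorname*{ess\,inf}_B f\right]d\mu+\sup_{B\in\mathcal D}\frac1{\mu(B)}\int_B|f|\,d\mu.$$ *)

theory Defs
  imports "HOL-Analysis.Analysis" "HOL-Probability.Essential_Supremum"
begin

(* The library's diameter is real-valued and unspecified on unbounded sets. *)
definition ediam :: "'a::metric_space set \<Rightarrow> ereal" where
  "ediam S = (SUP x\<in>S. SUP y\<in>S. ereal (dist x y))"

(* Regularity in the sense customary on metric spaces: outer by open sets, inner by closed
   sets. Inner approximation by compact sets would be more restrictive. *)
definition regular_borel_measure :: "'a::metric_space measure \<Rightarrow> bool" where
  "regular_borel_measure M \<longleftrightarrow> sets M = sets borel \<and>
     (\<forall>A\<in>sets M. emeasure M A = (INF U\<in>{U. open U \<and> A \<subseteq> U}. emeasure M U) \<and>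
                 emeasure M A = (SUP K\<in>{K. closed K \<and> K \<subseteq> A}. emeasure M K))"

definition RD_space :: "'a::metric_space measure \<Rightarrow> bool" where
  "RD_space M \<longleftrightarrow>
     regular_borel_measure M \<and>
     (\<forall>x r. r > 0 \<longrightarrow> 0 < emeasure M (ball x r) \<and> emeasure M (ball x r) < \<infinity>) \<and>
     (\<exists>A1\<ge>1. \<forall>x r. r > 0 \<longrightarrow> measure M (ball x (2 * r)) \<le> A1 * measure M (ball x r)) \<and>
     (\<exists>\<kappa> n A2 A3 :: real. 0 < \<kappa> \<and> \<kappa> \<le> n \<and> 0 < A2 \<and> A2 \<le> 1 \<and> 1 \<le> A3 \<and>
        (\<forall>x r l. 0 < r \<and> ereal r \<le> ediam (UNIV :: 'a set) / 2 \<and>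
                 1 \<le> l \<and> ereal l \<le> ediam (UNIV :: 'a set) / ereal (2 * r) \<longrightarrow>
           A2 * l powr \<kappa> * measure M (ball x r) \<le> measure M (ball x (l * r)) \<and>
           measure M (ball x (l * r)) \<le> A3 * l powr n * measure M (ball x r)))"

definition admissible :: "('a::metric_space \<Rightarrow> real) \<Rightarrow> bool" where
  "admissible \<rho> \<longleftrightarrow> (\<forall>x. \<rho> x > 0) \<and>
     (\<exists>C0 k0 :: real. C0 > 0 \<and> k0 > 0 \<and>
        (\<forall>x y. 1 / \<rho> x \<le> C0 * (1 / \<rho> y) * (1 + dist x y / \<rho> y) powr k0))"

(* A ball is represented by its (centre, radius) pair: membership in the collection D
   depends on this pair and not only on the underlying set. *)
definition balls :: "('a::metric_space \<times> real) set" where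
  "balls = {(x, r). r > 0}"

definition D_balls :: "('a::metric_space \<Rightarrow> real) \<Rightarrow> ('a \<times> real) set" where
  "D_balls \<rho> = {(x, r) \<in> balls. r \<ge> \<rho> x}"

definition L1_loc :: "'a::metric_space measure \<Rightarrow> ('a \<Rightarrow> real) set" where
  "L1_loc M = {f. \<forall>(x, r) \<in> balls. set_integrable M (ball x r) f}"

definition avg :: "'a measure \<Rightarrow> 'a set \<Rightarrow> ('a \<Rightarrow> real) \<Rightarrow> real" where
  "avg M B f = (LINT y:B|M. f y) / measure M B"

(* Mean value of a nonnegative, possibly infinite function. *)
definition nn_avg :: "'a measure \<Rightarrow> 'a set \<Rightarrow> ('a \<Rightarrow> ennreal) \<Rightarrow> ennreal" where
  "nn_avg M B u = (\<integral>\<^sup>+y\<in>B. u y \<partial>M) / emeasure M B"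

definition ess_inf_on :: "'a measure \<Rightarrow> 'a set \<Rightarrow> ('a \<Rightarrow> real) \<Rightarrow> ereal" where
  "ess_inf_on M B f = - esssup (restrict_space M B) (\<lambda>y. - ereal (f y))"

definition BMO_norm :: "'a::metric_space measure \<Rightarrow> ('a \<Rightarrow> real) \<Rightarrow> ('a \<Rightarrow> real) \<Rightarrow> ennreal" where
  "BMO_norm M \<rho> f =
     (SUP (x, r)\<in>balls - D_balls \<rho>.
        nn_avg M (ball x r) (\<lambda>y. ennreal \<bar>f y - avg M (ball x r) f\<bar>)) +
     (SUP (x, r)\<in>D_balls \<rho>. nn_avg M (ball x r) (\<lambda>y. ennreal \<bar>f y\<bar>))"

(* The essential infimum over a ball may be -\<infinity>, in which case the mean is \<infinity>.
   Truncation by e2ennreal only concerns a null set, as f is almost everywhere at least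
   its essential infimum. *)
definition BLO_norm :: "'a::metric_space measure \<Rightarrow> ('a \<Rightarrow> real) \<Rightarrow> ('a \<Rightarrow> real) \<Rightarrow> ennreal" where
  "BLO_norm M \<rho> f =
     (SUP (x, r)\<in>balls - D_balls \<rho>.
        nn_avg M (ball x r) (\<lambda>y. e2ennreal (ereal (f y) - ess_inf_on M (ball x r) f))) +
     (SUP (x, r)\<in>D_balls \<rho>. nn_avg M (ball x r) (\<lambda>y. ennreal \<bar>f y\<bar>))"

definition BMO :: "'a::metric_space measure \<Rightarrow> ('a \<Rightarrow> real) \<Rightarrow> ('a \<Rightarrow> real) set" where
  "BMO M \<rho> = {f \<in> L1_loc M. BMO_norm M \<rho> f < \<infinity>}"

definition BLO :: "'a::metric_space measure \<Rightarrow> ('a \<Rightarrow> real) \<Rightarrow> ('a \<Rightarrow> real) set" where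
  "BLO M \<rho> = {f \<in> L1_loc M. BLO_norm M \<rho> f < \<infinity>}"

definition Linf_norm :: "'a measure \<Rightarrow> ('a \<Rightarrow> real) \<Rightarrow> ennreal" where
  "Linf_norm M h = esssup M (\<lambda>x. ennreal \<bar>h x\<bar>)"

definition Linf :: "'a measure \<Rightarrow> ('a \<Rightarrow> real) set" where
  "Linf M = {h \<in> borel_measurable M. Linf_norm M h < \<infinity>}"

(* Extended-real-valued: the supremum may be infinite. *)
definition M_rho ::
  "'a::metric_space measure \<Rightarrow> ('a \<Rightarrow> real) \<Rightarrow> ('a \<Rightarrow> real) \<Rightarrow> 'a \<Rightarrow> ereal" where
  "M_rho M \<rho> g x =
     (SUP (z, r)\<in>{(z, r) \<in> balls - D_balls \<rho>. x \<in> ball z r}. ereal (avg M (ball z r) g))"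

(* Functions are identified when equal almost everywhere, so the equation f = M_rho g + h
   is an almost everywhere one; in particular it forces M_rho g to be finite almost
   everywhere, f being real-valued. *)
definition representations ::
  "'a::metric_space measure \<Rightarrow> ('a \<Rightarrow> real) \<Rightarrow> ('a \<Rightarrow> real) \<Rightarrow> (('a \<Rightarrow> real) \<times> ('a \<Rightarrow> real)) set" where
  "representations M \<rho> f =
     {(g, h). g \<in> BMO M \<rho> \<and> h \<in> Linf M \<and> (AE x in M. ereal (f x) = M_rho M \<rho> g x + ereal (h x))}"

end

theory Submission imports Defs begin

text \<open>
  Write \<open>g_B\<close> for the average of \<open>g\<close> over the ball \<open>B\<close>, and \<open>C\<close> for constants that depend only on
  the doubling constant and on the constants of \<open>\<rho>\<close>.

  A function \<open>f\<close> in BLO is represented by \<open>g = f\<close> and \<open>h = f - M_rho f\<close>. At almost every point \<open>x\<close>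
  the value \<open>f x\<close> is approached, from above and from below, by averages over arbitrarily small balls
  through \<open>x\<close> (\<open>AE_exists_small_ball_avg_greater\<close>). Such balls are outside \<open>D_balls \<rho>\<close>, so
  \<open>f x \<le> M_rho f x\<close>; and they are contained in any given ball \<open>B\<close> through \<open>x\<close>, so \<open>f x\<close> is at least
  the essential infimum of \<open>f\<close> over \<open>B\<close>, and \<open>f_B\<close> exceeds \<open>f x\<close> by at most the norm of \<open>f\<close>. Hence
  \<open>h\<close> is bounded (\<open>M_rho_close_to_BLO\<close>), and \<open>f\<close> is in BMO because its mean oscillation is at most
  twice its mean distance from the essential infimum.

  Conversely, let \<open>g\<close> be in BMO with norm at most \<open>N\<close> and fix a ball \<open>B\<close> of radius \<open>r\<close>. At a point
  \<open>x\<close> of \<open>B\<close>, the balls through \<open>x\<close> of radius at most \<open>r\<close> have averages of at most \<open>g_B + T x\<close>, where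
  the excess \<open>T\<close> is a local maximal function. A John-Nirenberg iteration, carried out for the maximal
  function instead of \<open>g\<close> (\<open>emeasure_upper_level_step\<close>), shows that its level sets decay
  exponentially; thus the mean of \<open>T\<close> over \<open>B\<close> is at most \<open>C N\<close> (\<open>nn_integral_upper_excess_le\<close>). A
  ball through \<open>x\<close> of radius larger than \<open>r\<close> has an enlargement that contains all of \<open>B\<close> and whose
  average differs by at most \<open>C N\<close>. Either the enlargement is outside \<open>D_balls \<rho>\<close> and competes in the
  supremum at every other point \<open>y\<close> of \<open>B\<close>, or it belongs to \<open>D_balls \<rho>\<close> and its average is at most
  \<open>N\<close>, whereas \<open>M_rho g\<close> is at least \<open>- C N\<close> everywhere. So, for \<open>B\<close> outside \<open>D_balls \<rho>\<close>,
  \<open>M_rho g x \<le> M_rho g y + T x + C N\<close> for all \<open>x\<close> and \<open>y\<close> in \<open>B\<close> (\<open>M_rho_le_on_small_ball\<close>), which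
  bounds the mean distance of \<open>M_rho g\<close> from its essential infimum. For \<open>B\<close> in \<open>D_balls \<rho>\<close>,
  admissibility of \<open>\<rho>\<close> places bounded enlargements of the large balls in \<open>D_balls \<rho>\<close>, and
  \<open>\<bar>M_rho g x\<bar> \<le> T x + C N\<close> (\<open>M_rho_le_on_large_ball\<close>).

  Both the differentiation property and the iteration rest on the Vitali covering lemma
  \<open>vitali_disjoint_subfamily\<close>.
\<close>

section \<open>Vitali coverings by balls\<close>

lemma ball_subset_enlarged:
  fixes z :: "'a::metric_space"
  assumes "ball z s \<inter> ball w t \<noteq> {}" "s \<le> 2 * t"
  shows "ball z s \<subseteq> ball w (5 * t)"
proof
  fix y assume y: "y \<in> ball z s"
  obtain p where p: "dist z p < s" "dist w p < t"
    using assms(1) by auto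
  have "dist w y \<le> dist w p + dist z p + dist z y"
    by (metis dist_commute dist_triangle dist_triangle_le add.assoc add_mono order_refl)
  then show "y \<in> ball w (5 * t)"
    using p y assms(2) by simp
qed

text \<open>
  Consider the disjoint subfamilies \<open>G\<close> such that every ball of \<open>F\<close> that meets a member of \<open>G\<close> meets
  one of at least half its radius, ordered by inclusion. A maximal \<open>G\<close> meets every ball of \<open>F\<close>:
  among the balls that miss it, one whose radius exceeds half the supremum of their radii could be
  added without losing the property.
\<close>

lemma vitali_disjoint_subfamily:
  fixes F :: "('a::metric_space \<times> real) set"
  assumes pos: "\<And>z s. (z, s) \<in> F \<Longrightarrow> 0 < s" and bdd: "\<And>z s. (z, s) \<in> F \<Longrightarrow> s \<le> R"
  obtains G where "G \<subseteq> F" "disjoint_family_on (\<lambda>(z, s). ball z s) G"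
    "\<And>z s. (z, s) \<in> F \<Longrightarrow> \<exists>w t. (w, t) \<in> G \<and> ball z s \<inter> ball w t \<noteq> {} \<and> s \<le> 2 * t"
proof -
  let ?b = "\<lambda>(z, s). ball (z::'a) s"
  let ?good = "\<lambda>G p. \<exists>q\<in>G. ?b p \<inter> ?b q \<noteq> {} \<and> snd p \<le> 2 * snd q"
  define \<Omega> where "\<Omega> = {G. G \<subseteq> F \<and> disjoint_family_on ?b G \<and>
    (\<forall>p\<in>F. \<forall>q\<in>G. ?b p \<inter> ?b q \<noteq> {} \<longrightarrow> ?good G p)}"
  have "\<exists>G\<in>\<Omega>. \<forall>X\<in>\<Omega>. G \<subseteq> X \<longrightarrow> X = G"
  proof (rule subset_Zorn')
    fix \<C> assume ch: "subset.chain \<Omega> \<C>"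
    have sub: "\<C> \<subseteq> \<Omega>" and lin: "\<And>X Y. X \<in> \<C> \<Longrightarrow> Y \<in> \<C> \<Longrightarrow> X \<subseteq> Y \<or> Y \<subseteq> X"
      using ch by (auto simp: subset.chain_def)
    have "disjoint_family_on ?b (\<Union>\<C>)"
      unfolding disjoint_family_on_def
    proof (intro ballI impI)
      fix p q assume "p \<in> \<Union>\<C>" "q \<in> \<Union>\<C>" and ne: "p \<noteq> q"
      then obtain X Y where XY: "X \<in> \<C>" "Y \<in> \<C>" "p \<in> X" "q \<in> Y" by blast
      then obtain Z where "Z \<in> \<C>" "p \<in> Z" "q \<in> Z" using lin by blast
      moreover from this have "disjoint_family_on ?b Z" using sub by (auto simp: \<Omega>_def)
      ultimately show "?b p \<inter> ?b q = {}"
        using disjoint_family_onD[where A = ?b and I = Z] ne by simp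
    qed
    moreover have "?good (\<Union>\<C>) p" if pq: "p \<in> F" "q \<in> \<Union>\<C>" "?b p \<inter> ?b q \<noteq> {}" for p q
    proof -
      obtain X where X: "X \<in> \<C>" "q \<in> X" using pq by blast
      then have "?good X p" using sub pq unfolding \<Omega>_def by blast
      then show ?thesis using X by blast
    qed
    ultimately show "\<Union>\<C> \<in> \<Omega>"
      using sub unfolding \<Omega>_def by blast
  qed
  then obtain G where G: "G \<in> \<Omega>" and max: "\<And>X. X \<in> \<Omega> \<Longrightarrow> G \<subseteq> X \<Longrightarrow> X = G" by blast
  have meets: "\<exists>q\<in>G. ?b p \<inter> ?b q \<noteq> {}" if "p \<in> F" for p
  proof (rule ccontr)
    assume none: "\<not> (\<exists>q\<in>G. ?b p \<inter> ?b q \<noteq> {})"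
    define F' where "F' = {p\<in>F. \<forall>q\<in>G. ?b p \<inter> ?b q = {}}"
    define \<sigma> where "\<sigma> = Sup (snd ` F')"
    have ne: "p \<in> F'" using none that by (auto simp: F'_def)
    have bd: "bdd_above (snd ` F')"
      by (rule bdd_aboveI[of _ R]) (use bdd in \<open>auto simp: F'_def\<close>)
    have "0 < snd p" using pos[of "fst p" "snd p"] that by simp
    also have "snd p \<le> \<sigma>" unfolding \<sigma>_def by (rule cSup_upper) (use ne bd in auto)
    finally have "\<sigma> / 2 < \<sigma>" by simp
    then obtain q where q: "q \<in> F'" "\<sigma> / 2 < snd q"
      unfolding \<sigma>_def using less_cSup_iff[of "snd ` F'"] ne bd by blast
    have le: "snd p' \<le> 2 * snd q" if "p' \<in> F'" for p'
    proof -
      have "snd p' \<le> \<sigma>" unfolding \<sigma>_def by (rule cSup_upper) (use that bd in auto)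
      then show ?thesis using q by simp
    qed
    have "0 < snd q" using pos[of "fst q" "snd q"] q by (simp add: F'_def)
    then have qq: "?b q \<noteq> {}" by (cases q) auto
    have "insert q G \<in> \<Omega>"
      unfolding \<Omega>_def
    proof (intro CollectI conjI ballI impI)
      show "insert q G \<subseteq> F" using G q by (auto simp: \<Omega>_def F'_def)
      show "disjoint_family_on ?b (insert q G)"
        using G q by (auto simp: \<Omega>_def F'_def disjoint_family_on_def)
      fix p' q' assume p': "p' \<in> F" and q': "q' \<in> insert q G" "?b p' \<inter> ?b q' \<noteq> {}"
      show "?good (insert q G) p'"
      proof (cases "p' \<in> F'")
        case True
        then have "q' = q" using q' by (auto simp: F'_def)
        then show ?thesis using q' le[OF True] by blast
      next
        case False
        then obtain q'' where "q'' \<in> G" "?b p' \<inter> ?b q'' \<noteq> {}" using p' by (auto simp: F'_def)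
        then have "?good G p'" using G p' unfolding \<Omega>_def by blast
        then show ?thesis by blast
      qed
    qed
    then have "q \<in> G" using max by blast
    then show False using q qq by (auto simp: F'_def)
  qed
  show ?thesis
  proof (rule that[of G])
    show "G \<subseteq> F" "disjoint_family_on ?b G" using G by (auto simp: \<Omega>_def)
    fix z s assume zs: "(z, s) \<in> F"
    then have "?good G (z, s)" using meets[OF zs] G unfolding \<Omega>_def by blast
    then show "\<exists>w t. (w, t) \<in> G \<and> ball z s \<inter> ball w t \<noteq> {} \<and> s \<le> 2 * t" by fastforce
  qed
qed

text \<open>
  This passes from a comparison ball by ball to a comparison of unions. With \<open>N = M\<close> it bounds a set
  covered by enlarged balls by the union of the selected disjoint balls; with \<open>N\<close> a density it turns
  lower bounds for averages over disjoint balls into a bound for their total measure.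
\<close>

lemma emeasure_UN_le_disjoint_UN:
  fixes a :: ennreal
  assumes G: "countable G"
    and X: "\<And>i. i \<in> G \<Longrightarrow> X i \<in> sets M" and Y: "\<And>i. i \<in> G \<Longrightarrow> Y i \<in> sets N"
    and disj: "disjoint_family_on Y G"
    and le: "\<And>i. i \<in> G \<Longrightarrow> emeasure M (X i) \<le> a * emeasure N (Y i)"
  shows "emeasure M (\<Union>i\<in>G. X i) \<le> a * emeasure N (\<Union>i\<in>G. Y i)"
proof -
  let ?I = "to_nat_on G ` G"
  define X' where "X' n = (if n \<in> ?I then X (from_nat_into G n) else {})" for n
  define Y' where "Y' n = (if n \<in> ?I then Y (from_nat_into G n) else {})" for n
  have UX: "(\<Union>i\<in>G. X i) = (\<Union>n. X' n)" and UY: "(\<Union>i\<in>G. Y i) = (\<Union>n. Y' n)"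
    using G by (auto simp: X'_def Y'_def split: if_splits)
  have mX: "X' n \<in> sets M" and mY: "Y' n \<in> sets N" for n
    using G X Y by (auto simp: X'_def Y'_def)
  have dY: "disjoint_family Y'"
    using disjoint_family_onD[OF disj] G by (fastforce simp: disjoint_family_on_def Y'_def)
  have le': "emeasure M (X' n) \<le> a * emeasure N (Y' n)" for n
    using G le by (auto simp: X'_def Y'_def)
  have "emeasure M (\<Union>n. X' n) \<le> (\<Sum>n. emeasure M (X' n))"
    by (rule emeasure_subadditive_countably) (use mX in auto)
  also have "\<dots> \<le> (\<Sum>n. a * emeasure N (Y' n))"
    by (rule suminf_le) (use le' in auto)
  also have "\<dots> = a * (\<Sum>n. emeasure N (Y' n))" by simp
  also have "(\<Sum>n. emeasure N (Y' n)) = emeasure N (\<Union>n. Y' n)"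
    by (rule suminf_emeasure) (use mY dY in auto)
  finally show ?thesis unfolding UX UY .
qed

text \<open>
  The measures of the sets are summable, as finite partial sums are bounded by the measure of \<open>W\<close>,
  and a summable family has only countably many nonzero terms.
\<close>

lemma countable_disjoint_positive_measure:
  assumes W: "W \<in> fmeasurable M"
    and B: "\<And>i. i \<in> G \<Longrightarrow> B i \<in> sets M" "\<And>i. i \<in> G \<Longrightarrow> B i \<subseteq> W"
      "\<And>i. i \<in> G \<Longrightarrow> 0 < measure M (B i)"
    and disj: "disjoint_family_on B G"
  shows "countable G"
proof -
  have fm: "B i \<in> fmeasurable M" if "i \<in> G" for i
    using fmeasurableI2[OF W] B that by blast
  have "(\<lambda>i. measure M (B i)) summable_on G"
  proof (rule nonneg_bdd_above_summable_on)
    show "bdd_above (sum (\<lambda>i. measure M (B i)) ` {F. F \<subseteq> G \<and> finite F})"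
    proof (rule bdd_aboveI[of _ "measure M W"], clarsimp)
      fix F assume F: "F \<subseteq> G" "finite F"
      have "(\<Sum>i\<in>F. measure M (B i)) = measure M (\<Union>i\<in>F. B i)"
        using F fm disjoint_family_onD[OF disj]
        by (intro measure_UNION'[symmetric])
           (auto simp: pairwise_def disjnt_def subset_iff)
      also have "\<dots> \<le> measure M W"
        by (rule measure_mono_fmeasurable) (use F B W in \<open>auto intro!: sets.finite_UN\<close>)
      finally show "(\<Sum>i\<in>F. measure M (B i)) \<le> measure M W" .
    qed
  qed simp
  then have "countable {i\<in>G. measure M (B i) \<noteq> 0}"
    by (rule summable_countable_real)
  moreover have "{i\<in>G. measure M (B i) \<noteq> 0} = G" using B(3) by force
  ultimately show ?thesis by simp
qed

section \<open>Doubling measures\<close>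

locale doubling_measure =
  fixes M :: "'a::metric_space measure" and A :: real
  assumes sets_eq_borel: "sets M = sets borel"
    and emeasure_ball_pos: "0 < r \<Longrightarrow> 0 < emeasure M (ball x r)"
    and emeasure_ball_finite: "0 < r \<Longrightarrow> emeasure M (ball x r) < \<infinity>"
    and A_ge_1: "1 \<le> A"
    and doubling: "0 < r \<Longrightarrow> measure M (ball x (2 * r)) \<le> A * measure M (ball x r)"
    and outer_regular: "S \<in> sets M \<Longrightarrow> emeasure M S = (INF U\<in>{U. open U \<and> S \<subseteq> U}. emeasure M U)"
begin

lemma space_eq_UNIV [simp]: "space M = UNIV"
  using sets_eq_imp_space_eq[OF sets_eq_borel] by simp

lemma open_in_sets: "open S \<Longrightarrow> S \<in> sets M"
  by (simp add: sets_eq_borel)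

lemma ball_in_sets [simp, measurable]: "ball x r \<in> sets M"
  by (simp add: open_in_sets)

lemma ball_fmeasurable [simp]: "ball x r \<in> fmeasurable M"
  using emeasure_ball_finite[of r x] by (cases "0 < r") (auto intro: fmeasurableI simp: ball_empty)

lemma emeasure_ball_eq: "emeasure M (ball x r) = ennreal (measure M (ball x r))"
  by (simp add: emeasure_eq_measure2)

lemma measure_ball_pos: "0 < r \<Longrightarrow> 0 < measure M (ball x r)"
  using emeasure_ball_pos[of r x] by (simp add: emeasure_ball_eq)

lemma A_power_ge_1: "1 \<le> A ^ k"
  using A_ge_1 by simp

lemma doubling_power: "0 < r \<Longrightarrow> measure M (ball x (2 ^ k * r)) \<le> A ^ k * measure M (ball x r)"
proof (induction k)
  case (Suc k)
  have "measure M (ball x (2 ^ Suc k * r)) \<le> A * measure M (ball x (2 ^ k * r))"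
    using doubling[of "2 ^ k * r" x] Suc.prems by (simp add: mult.assoc)
  also have "\<dots> \<le> A * (A ^ k * measure M (ball x r))"
    using Suc A_ge_1 by (intro mult_left_mono) auto
  finally show ?case by (simp add: mult.assoc)
qed simp

lemma measure_ball_le:
  assumes "0 < r" "dist x y + t \<le> 2 ^ k * r"
  shows "measure M (ball y t) \<le> A ^ k * measure M (ball x r)"
proof -
  have "ball y t \<subseteq> ball x (2 ^ k * r)"
  proof
    fix p assume "p \<in> ball y t"
    then show "p \<in> ball x (2 ^ k * r)"
      using assms(2) dist_triangle[of x p y] by simp
  qed
  then have "measure M (ball y t) \<le> measure M (ball x (2 ^ k * r))"
    by (intro measure_mono_fmeasurable) auto
  also have "\<dots> \<le> A ^ k * measure M (ball x r)" by (rule doubling_power) fact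
  finally show ?thesis .
qed

lemma L1_loc_set_integrable: "f \<in> L1_loc M \<Longrightarrow> set_integrable M (ball x r) f"
  by (cases "0 < r") (auto simp: L1_loc_def balls_def ball_empty)

lemma L1_loc_measurable:
  assumes "f \<in> L1_loc M"
  shows "f \<in> borel_measurable M"
proof (rule borel_measurable_LIMSEQ_real)
  fix n :: nat
  show "(\<lambda>x. indicator (ball (undefined :: 'a) (real n)) x * f x) \<in> borel_measurable M"
    using L1_loc_set_integrable[OF assms, of "undefined :: 'a" "real n"]
    by (auto simp: set_integrable_def)
next
  fix x
  obtain N :: nat where N: "dist (undefined :: 'a) x < real N" using reals_Archimedean2 by blast
  have "eventually (\<lambda>n. indicator (ball (undefined :: 'a) (real n)) x * f x = f x) sequentially"
    using eventually_ge_at_top[of N] by eventually_elim (use N in auto)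
  then show "(\<lambda>n. indicator (ball (undefined :: 'a) (real n)) x * f x) \<longlonglongrightarrow> f x"
    by (rule tendsto_eventually)
qed

lemma L1_loc_uminus: "f \<in> L1_loc M \<Longrightarrow> (\<lambda>x. - f x) \<in> L1_loc M"
  by (auto simp: L1_loc_def set_integrable_def split: prod.splits)

end

section \<open>Averages\<close>

lemma set_integrable_const: "B \<in> fmeasurable M \<Longrightarrow> set_integrable M B (\<lambda>_. c :: real)"
  by (auto simp: set_integrable_def fmeasurable_def)

lemma avg_diff_const:
  assumes "set_integrable M B f" "B \<in> fmeasurable M" "0 < measure M B"
  shows "avg M B (\<lambda>y. f y - c) = avg M B f - c"
proof -
  have "(LINT y:B|M. f y - c) = (LINT y:B|M. f y) - c * measure M B"
    using assms by (subst set_integral_diff) (auto simp: set_integrable_const set_lebesgue_integral_def fmeasurableD mult.commute)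
  then show ?thesis using assms by (simp add: avg_def diff_divide_distrib)
qed

lemma avg_mono_AE:
  assumes "set_integrable M B f" "set_integrable M B g" "B \<in> sets M"
    and "AE y in M. y \<in> B \<longrightarrow> f y \<le> g y"
  shows "avg M B f \<le> avg M B g"
  unfolding avg_def
  by (intro divide_right_mono set_integral_mono_AE) (use assms in auto)

lemma abs_avg_diff_le:
  assumes "set_integrable M B f" "B \<in> fmeasurable M" "0 < measure M B"
  shows "\<bar>avg M B f - c\<bar> \<le> avg M B (\<lambda>y. \<bar>f y - c\<bar>)"
proof -
  have "\<bar>LINT y:B|M. f y - c\<bar> \<le> (LINT y:B|M. \<bar>f y - c\<bar>)"
    unfolding set_lebesgue_integral_def
    by (rule order_trans[OF integral_abs_bound]) (simp add: abs_mult)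
  then have "\<bar>avg M B (\<lambda>y. f y - c)\<bar> \<le> avg M B (\<lambda>y. \<bar>f y - c\<bar>)"
    unfolding avg_def using assms by (simp add: divide_right_mono)
  then show ?thesis by (simp add: avg_diff_const[OF assms])
qed

lemma avg_le_avg_superset:
  assumes "set_integrable M Q u" "\<And>y. 0 \<le> u y" "P \<in> sets M" "P \<subseteq> Q"
    and "0 < measure M P" "measure M Q \<le> c * measure M P" "0 < measure M Q"
  shows "avg M P u \<le> c * avg M Q u"
proof -
  let ?I = "LINT y:Q|M. u y"
  have P: "set_integrable M P u" using assms set_integrable_subset by blast
  have "(LINT y:P|M. u y) \<le> ?I"
    unfolding set_lebesgue_integral_def
    by (rule integral_mono) (use assms P in \<open>auto simp: set_integrable_def indicator_def\<close>)
  then have "avg M P u \<le> ?I / measure M P"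
    unfolding avg_def using assms by (simp add: divide_right_mono)
  also have "\<dots> \<le> c * (?I / measure M Q)"
  proof -
    have "0 \<le> ?I" unfolding set_lebesgue_integral_def using assms by simp
    then have "?I * measure M Q \<le> ?I * (c * measure M P)"
      using assms by (intro mult_left_mono)
    then show ?thesis using assms by (simp add: field_simps)
  qed
  finally show ?thesis by (simp add: avg_def)
qed

text \<open>
  This is the one comparison behind all later changes of balls: replacing a ball by a larger one of
  comparable measure costs a constant times the mean deviation over the larger ball.
\<close>

lemma abs_avg_diff_superset_le:
  assumes "set_integrable M Q f" "Q \<in> fmeasurable M" "P \<in> sets M" "P \<subseteq> Q"
    and "0 < measure M P" "measure M Q \<le> c * measure M P"
  shows "\<bar>avg M P f - d\<bar> \<le> c * avg M Q (\<lambda>y. \<bar>f y - d\<bar>)"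
proof -
  have P: "P \<in> fmeasurable M" using assms fmeasurableI2 by blast
  have Q: "0 < measure M Q" using assms measure_mono_fmeasurable[of P Q M] by linarith
  have "\<bar>avg M P f - d\<bar> \<le> avg M P (\<lambda>y. \<bar>f y - d\<bar>)"
    by (rule abs_avg_diff_le) (use assms P set_integrable_subset in blast)+
  also have "\<dots> \<le> c * avg M Q (\<lambda>y. \<bar>f y - d\<bar>)"
    by (rule avg_le_avg_superset) (use assms Q in \<open>auto intro!: set_integrable_abs set_integral_diff set_integrable_const\<close>)
  finally show ?thesis .
qed

section \<open>One-sided Lebesgue differentiation\<close>

context doubling_measure
begin

text \<open>
  Let \<open>C\<close> be a small ball inside \<open>U\<close> that meets \<open>E\<close>. The integral of \<open>f - a\<close> over \<open>C\<close> is not positive,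
  while \<open>f - a\<close> exceeds \<open>b - a\<close> on \<open>C \<inter> E\<close>; so \<open>(b - a) \<mu>(C \<inter> E)\<close> is at most the integral of
  \<open>\<bar>f - a\<bar>\<close> over \<open>C - E\<close>, which means that \<open>\<mu>(C)\<close> is at most the mass that the density gives to
  \<open>C - E\<close>. Sum this over a disjoint Vitali subfamily, whose enlargements cover \<open>E\<close>; the factor
  \<open>A\<^sup>3\<close> accounts for enlarging by 5, which is less than \<open>2\<^sup>3\<close>.
\<close>

lemma emeasure_le_complement_density:
  assumes f: "f \<in> L1_loc M" and ab: "a < b" and d: "0 < \<delta>"
    and E: "E \<in> sets M" "E \<subseteq> U" and U: "open U" "U \<subseteq> ball x0 R"
    and big: "\<And>x. x \<in> E \<Longrightarrow> b < f x"
    and small: "\<And>x z s. x \<in> E \<Longrightarrow> 0 < s \<Longrightarrow> s < \<delta> \<Longrightarrow> dist z x < s \<Longrightarrow> avg M (ball z s) f \<le> a"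
  shows "emeasure M E \<le> ennreal (A ^ 3) * emeasure (density M (\<lambda>x. ennreal (\<bar>f x - a\<bar> / (b - a) + 1))) (U - E)"
proof -
  define \<Lambda> where "\<Lambda> = density M (\<lambda>x. ennreal (\<bar>f x - a\<bar> / (b - a) + 1))"
  note [measurable] = L1_loc_measurable[OF f] E(1) open_in_sets[OF U(1)]
  have sets\<Lambda>: "sets \<Lambda> = sets M" by (simp add: \<Lambda>_def)
  define F where "F = {(z, s). 0 < s \<and> s < \<delta> \<and> ball z s \<subseteq> U \<and> ball z s \<inter> E \<noteq> {}}"
  obtain G where G: "G \<subseteq> F" "disjoint_family_on (\<lambda>(z, s). ball z s) G"
    "\<And>z s. (z, s) \<in> F \<Longrightarrow> \<exists>w t. (w, t) \<in> G \<and> ball z s \<inter> ball w t \<noteq> {} \<and> s \<le> 2 * t"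
    by (rule vitali_disjoint_subfamily[of F \<delta>]) (auto simp: F_def)
  have cG: "countable G"
    by (rule countable_disjoint_positive_measure[of "ball x0 R" M G "\<lambda>(z, s). ball z s"])
       (use G(1,2) U(2) in \<open>fastforce simp: F_def intro!: measure_ball_pos\<close>)+
  have bound: "emeasure M (ball z (5 * s)) \<le> ennreal (A ^ 3) * emeasure \<Lambda> (ball z s - E)"
    if zs: "(z, s) \<in> G" for z s
  proof -
    let ?C = "ball z s"
    have s: "0 < s" "s < \<delta>" and "?C \<inter> E \<noteq> {}" using G zs by (auto simp: F_def)
    then have "avg M ?C f \<le> a" using small by auto
    have int: "set_integrable M ?C (\<lambda>y. f y - a)"
      by (intro set_integral_diff L1_loc_set_integrable f set_integrable_const ball_fmeasurable)
    have i1: "set_integrable M (?C \<inter> E) (\<lambda>y. f y - a)" and i2: "set_integrable M (?C - E) (\<lambda>y. f y - a)"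
      by (rule set_integrable_subset[OF int]; simp)+
    have f1: "?C \<inter> E \<in> fmeasurable M" and f2: "?C - E \<in> fmeasurable M"
      by (rule fmeasurableI2[of ?C]; simp)+
    have "avg M ?C (\<lambda>y. f y - a) \<le> 0"
      using avg_diff_const[OF L1_loc_set_integrable[OF f] ball_fmeasurable measure_ball_pos[OF s(1)]]
        \<open>avg M ?C f \<le> a\<close> by simp
    then have "(LINT y:?C|M. f y - a) \<le> 0"
      using measure_ball_pos[OF s(1), of z] by (simp add: avg_def divide_le_0_iff)
    moreover have "(LINT y:?C|M. f y - a) = (LINT y:?C \<inter> E|M. f y - a) + (LINT y:?C - E|M. f y - a)"
      using set_integral_Un[OF _ i1 i2] by (simp add: Int_Diff_Un Int_Diff Int_Diff_disjoint)
    moreover have "(b - a) * measure M (?C \<inter> E) \<le> (LINT y:?C \<inter> E|M. f y - a)"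
    proof -
      have "(LINT y:?C \<inter> E|M. b - a) \<le> (LINT y:?C \<inter> E|M. f y - a)"
        by (rule set_integral_mono) (use big i1 f1 in \<open>auto simp: set_integrable_const intro: less_imp_le\<close>)
      then show ?thesis using f1 by (simp add: set_lebesgue_integral_def mult.commute)
    qed
    moreover have "- (LINT y:?C - E|M. \<bar>f y - a\<bar>) \<le> (LINT y:?C - E|M. f y - a)"
    proof -
      have "(LINT y:?C - E|M. - \<bar>f y - a\<bar>) \<le> (LINT y:?C - E|M. f y - a)"
        by (rule set_integral_mono) (use i2 set_integrable_abs[OF i2] in \<open>auto simp: set_integrable_def\<close>)
      then show ?thesis using i2 by (simp add: set_integral_uminus set_integrable_abs)
    qed
    ultimately have key: "(b - a) * measure M (?C \<inter> E) \<le> (LINT y:?C - E|M. \<bar>f y - a\<bar>)" by linarith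
    have "measure M ?C = measure M (?C \<inter> E) + measure M (?C - E)"
      using measure_Union[of M "?C \<inter> E" "?C - E"] fmeasurableD2[OF f1] fmeasurableD2[OF f2]
      by (simp add: Int_Diff_Un Int_Diff_disjoint)
    also have "\<dots> \<le> (LINT y:?C - E|M. \<bar>f y - a\<bar>) / (b - a) + measure M (?C - E)"
      using key ab by (simp add: field_simps)
    also have "\<dots> = (LINT y:?C - E|M. \<bar>f y - a\<bar> / (b - a) + 1)"
      using i2 f2 by (subst set_integral_add) (auto simp: set_integrable_const set_integrable_abs set_lebesgue_integral_def)
    finally have "ennreal (measure M ?C) \<le> ennreal (LINT y:?C - E|M. \<bar>f y - a\<bar> / (b - a) + 1)"
      by (rule ennreal_leI)
    also have "\<dots> = (\<integral>\<^sup>+y\<in>?C - E. ennreal (\<bar>f y - a\<bar> / (b - a) + 1) \<partial>M)"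
    proof -
      have "set_integrable M (?C - E) (\<lambda>y. \<bar>f y - a\<bar> / (b - a) + 1)"
        using i2 f2 by (intro set_integral_add set_integrable_divide set_integrable_abs set_integrable_const)
      then show ?thesis
        unfolding set_lebesgue_integral_def set_integrable_def using ab
        by (subst nn_integral_eq_integral[symmetric])
           (auto intro!: nn_integral_cong simp: indicator_def)
    qed
    also have "\<dots> = emeasure \<Lambda> (?C - E)"
      unfolding \<Lambda>_def by (subst emeasure_density) auto
    finally have *: "ennreal (measure M ?C) \<le> emeasure \<Lambda> (?C - E)" .
    have "emeasure M (ball z (5 * s)) \<le> ennreal (A ^ 3 * measure M ?C)"
      unfolding emeasure_ball_eq by (intro ennreal_leI measure_ball_le) (use s in auto)
    also have "\<dots> = ennreal (A ^ 3) * ennreal (measure M ?C)"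
      using A_ge_1 by (simp add: ennreal_mult)
    also have "\<dots> \<le> ennreal (A ^ 3) * emeasure \<Lambda> (?C - E)"
      by (intro mult_left_mono *) simp
    finally show ?thesis .
  qed
  have "E \<subseteq> (\<Union>(z, s)\<in>G. ball z (5 * s))"
  proof
    fix x assume x: "x \<in> E"
    then obtain e where e: "0 < e" "ball x e \<subseteq> U" using U E open_contains_ball by blast
    define s where "s = min e (\<delta> / 2)"
    have "ball x s \<subseteq> U" using e by (auto simp: s_def)
    moreover have "x \<in> ball x s" using e d by (simp add: s_def)
    moreover from this have "ball x s \<inter> E \<noteq> {}" using x by blast
    moreover have "0 < s" "s < \<delta>" using e d by (auto simp: s_def)
    ultimately have "(x, s) \<in> F" by (simp add: F_def)
    then obtain w t where wt: "(w, t) \<in> G" "ball x s \<inter> ball w t \<noteq> {}" "s \<le> 2 * t" using G(3) by blast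
    then have "x \<in> ball w (5 * t)"
      using ball_subset_enlarged[OF wt(2,3)] \<open>x \<in> ball x s\<close> by blast
    then show "x \<in> (\<Union>(z, s)\<in>G. ball z (5 * s))" using wt by blast
  qed
  then have "emeasure M E \<le> emeasure M (\<Union>p\<in>G. ball (fst p) (5 * snd p))"
    by (intro emeasure_mono) (auto intro!: open_in_sets simp: case_prod_beta)
  also have "\<dots> \<le> ennreal (A ^ 3) * emeasure \<Lambda> (\<Union>p\<in>G. ball (fst p) (snd p) - E)"
  proof (rule emeasure_UN_le_disjoint_UN[OF cG])
    show "disjoint_family_on (\<lambda>p. ball (fst p) (snd p) - E) G"
      using G(2) unfolding disjoint_family_on_def by (fastforce simp: case_prod_beta)
  qed (auto simp: bound sets\<Lambda>)
  also have "\<dots> \<le> ennreal (A ^ 3) * emeasure \<Lambda> (U - E)"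
  proof (intro mult_left_mono emeasure_mono)
    have "ball (fst p) (snd p) \<subseteq> U" if "p \<in> G" for p
      using G(1) that by (fastforce simp: F_def)
    then show "(\<Union>p\<in>G. ball (fst p) (snd p) - E) \<subseteq> U - E" by blast
  qed (auto simp: sets\<Lambda>)
  finally show ?thesis by (simp add: \<Lambda>_def)
qed


text \<open>
  By outer regularity there are open sets \<open>V n\<close> that decrease to \<open>E\<close> up to a null set. The density
  of the previous lemma has finite mass on balls and vanishes on null sets, so its mass on
  \<open>V n - E\<close> tends to 0, and with it the bound for \<open>\<mu>(E)\<close>.
\<close>

lemma null_sets_averages_below:
  assumes f: "f \<in> L1_loc M" and ab: "a < b" and d: "0 < \<delta>"
  shows "{x \<in> ball x0 R. b < f x \<and> (\<forall>z s. 0 < s \<longrightarrow> s < \<delta> \<longrightarrow> dist z x < s \<longrightarrow> avg M (ball z s) f \<le> a)} \<in> null_sets M"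
    (is "?E \<in> _")
proof -
  note [measurable] = L1_loc_measurable[OF f]
  let ?W = "ball x0 R"
  define \<Lambda> where "\<Lambda> = density M (\<lambda>x. ennreal (\<bar>f x - a\<bar> / (b - a) + 1))"
  have sets\<Lambda>: "sets \<Lambda> = sets M" by (simp add: \<Lambda>_def)
  define E where "E = ?E"
  have EW: "E \<subseteq> ?W" by (auto simp: E_def)
  have "E = {x\<in>space M. b < f x} \<inter> (?W - (\<Union>(z, s)\<in>{(z, s). 0 < s \<and> s < \<delta> \<and> a < avg M (ball z s) f}. ball z s))"
    by (auto simp: E_def not_less) (metis linorder_not_le)+
  also have "\<dots> \<in> sets M"
    by (intro sets.Int[OF borel_measurable_less sets.Diff[OF ball_in_sets open_in_sets]])
       (auto intro!: open_UN)
  finally have E[measurable]: "E \<in> sets M" .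
  have finE: "emeasure M E < \<infinity>"
    using fmeasurableI2[OF ball_fmeasurable EW E] by (auto simp: fmeasurable_def)
  have "\<exists>U. open U \<and> E \<subseteq> U \<and> emeasure M U < emeasure M E + ennreal (1 / Suc n)" for n
  proof -
    have "emeasure M E < emeasure M E + ennreal (1 / Suc n)"
      using finE by (cases "emeasure M E") (auto simp: ennreal_plus[symmetric] ennreal_less_iff simp del: ennreal_plus)
    then have "(INF U\<in>{U. open U \<and> E \<subseteq> U}. emeasure M U) < emeasure M E + ennreal (1 / Suc n)"
      using outer_regular[OF E] by simp
    then show ?thesis by (auto simp: INF_less_iff)
  qed
  then obtain U where U: "\<And>n. open (U n)" "\<And>n. E \<subseteq> U n"
    "\<And>n. emeasure M (U n) < emeasure M E + ennreal (1 / Suc n)" by metis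
  define V where "V n = ?W \<inter> (\<Inter>j\<le>n. U j)" for n
  have V: "open (V n)" "E \<subseteq> V n" "V n \<subseteq> ?W" "V n \<subseteq> U n" for n
    using U EW by (auto simp: V_def intro!: open_Int open_INT)
  have [measurable]: "V n \<in> sets M" for n by (rule open_in_sets[OF V(1)])
  have VE: "V n - E \<in> sets M" for n by measurable
  have le: "emeasure M (V n - E) \<le> ennreal (1 / Suc n)" for n
  proof -
    have "emeasure M (V n - E) = emeasure M (V n) - emeasure M E"
      using finE V(2) by (intro emeasure_Diff) auto
    also have "\<dots> \<le> emeasure M (U n) - emeasure M E"
      by (rule ennreal_minus_mono[OF emeasure_mono[OF V(4) open_in_sets[OF U(1)]] order_refl])
    also have "\<dots> \<le> ennreal (1 / Suc n)"
      using U(3)[of n] by (subst ennreal_minus_le_iff) (auto simp: less_imp_le finE[THEN less_imp_neq] dest: less_imp_le)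
    finally show ?thesis .
  qed
  have "emeasure M (\<Inter>n. V n - E) \<le> ennreal (1 / Suc n)" for n
    by (rule order_trans[OF emeasure_mono[OF _ VE] le]) auto
  then have "emeasure M (\<Inter>n. V n - E) \<le> 0"
    by (intro LIMSEQ_le_const[where X = "\<lambda>n. ennreal (1 / Suc n)"])
       (auto intro!: tendsto_ennrealI[of _ 0, simplified] LIMSEQ_Suc[OF lim_1_over_n, simplified])
  then have "(\<Inter>n. V n - E) \<in> null_sets M" by auto
  then have null: "emeasure \<Lambda> (\<Inter>n. V n - E) = 0"
    unfolding \<Lambda>_def by (subst emeasure_density) (auto intro!: nn_integral_0_iff_AE[THEN iffD2] dest: AE_not_in)
  have finL: "emeasure \<Lambda> (V n - E) \<noteq> \<infinity>" for n
  proof -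
    have "set_integrable M ?W (\<lambda>y. \<bar>f y - a\<bar> / (b - a) + 1)"
      by (intro set_integral_add set_integrable_divide set_integrable_abs set_integral_diff
          set_integrable_const ball_fmeasurable L1_loc_set_integrable f)
    then have "(\<integral>\<^sup>+y. ennreal (indicator ?W y * (\<bar>f y - a\<bar> / (b - a) + 1)) \<partial>M) < \<infinity>"
      unfolding set_integrable_def by (subst (asm) integrable_iff_bounded) (use ab in auto)
    also have "(\<integral>\<^sup>+y. ennreal (indicator ?W y * (\<bar>f y - a\<bar> / (b - a) + 1)) \<partial>M) = emeasure \<Lambda> ?W"
      unfolding \<Lambda>_def by (subst emeasure_density) (auto intro!: nn_integral_cong simp: indicator_def)
    finally have "emeasure \<Lambda> ?W < \<infinity>" .
    moreover have "emeasure \<Lambda> (V n - E) \<le> emeasure \<Lambda> ?W"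
      by (rule emeasure_mono) (use V(3)[of n] in \<open>auto simp: sets\<Lambda>\<close>)
    ultimately show ?thesis by (simp add: top.not_eq_extremum)
  qed
  have "(\<lambda>n. emeasure \<Lambda> (V n - E)) \<longlonglongrightarrow> emeasure \<Lambda> (\<Inter>n. V n - E)"
  proof (rule Lim_emeasure_decseq)
    show "range (\<lambda>n. V n - E) \<subseteq> sets \<Lambda>" using VE by (auto simp: sets\<Lambda>)
    show "decseq (\<lambda>n. V n - E)" by (auto simp: decseq_def V_def)
  qed (rule finL)
  then have "(\<lambda>n. ennreal (A ^ 3) * emeasure \<Lambda> (V n - E)) \<longlonglongrightarrow> ennreal (A ^ 3) * 0"
    unfolding null by (intro ennreal_tendsto_cmult) auto
  then have "emeasure M E \<le> ennreal (A ^ 3) * 0"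
  proof (rule LIMSEQ_le_const, intro exI allI impI)
    fix n
    show "emeasure M E \<le> ennreal (A ^ 3) * emeasure \<Lambda> (V n - E)"
      unfolding \<Lambda>_def by (rule emeasure_le_complement_density[OF f ab d E V(2,1,3)]) (auto simp: E_def)
  qed
  then have "E \<in> null_sets M" using E by auto
  then show ?thesis by (simp add: E_def)
qed

text \<open>
  This is one half of Lebesgue's differentiation theorem, for balls that contain the point and need
  not be centred there. The other half is the same statement for \<open>- f\<close>.
\<close>

lemma AE_exists_small_ball_avg_greater:
  assumes f: "f \<in> L1_loc M"
  shows "AE x in M. \<forall>\<delta>>0. \<forall>a<f x. \<exists>z s. 0 < s \<and> s < \<delta> \<and> dist z x < s \<and> a < avg M (ball z s) f"
proof -
  define E where "E n m p q = {x \<in> ball (undefined :: 'a) (real n). real_of_rat q < f x \<and>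
    (\<forall>z s. 0 < s \<longrightarrow> s < 1 / Suc m \<longrightarrow> dist z x < s \<longrightarrow> avg M (ball z s) f \<le> real_of_rat p)}" for n m p q
  have "AE x in M. \<forall>n m p q. p < q \<longrightarrow> x \<notin> E n m p q"
    unfolding AE_all_countable
  proof (intro allI)
    fix n m p q
    show "AE x in M. p < q \<longrightarrow> x \<notin> E n m p q"
    proof (cases "p < q")
      case True
      then have "E n m p q \<in> null_sets M"
        unfolding E_def by (intro null_sets_averages_below f) (auto simp: of_rat_less)
      then show ?thesis by (auto dest: AE_not_in)
    qed simp
  qed
  then show ?thesis
  proof eventually_elim
    case (elim x)
    show ?case
    proof (intro allI impI, rule ccontr)
      fix \<delta> a :: real
      assume d: "0 < \<delta>" and a: "a < f x"
        and no: "\<not> (\<exists>z s. 0 < s \<and> s < \<delta> \<and> dist z x < s \<and> a < avg M (ball z s) f)"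
      obtain p where p: "a < real_of_rat p" "real_of_rat p < f x" using of_rat_dense[OF a] by blast
      obtain q where q: "real_of_rat p < real_of_rat q" "real_of_rat q < f x" using of_rat_dense[OF p(2)] by blast
      obtain m where m: "1 / Suc m < \<delta>" using nat_approx_posE[OF d] by (metis)
      obtain n :: nat where n: "dist (undefined :: 'a) x < real n" using reals_Archimedean2 by blast
      have "x \<in> E n m p q"
        unfolding E_def
      proof (intro CollectI conjI allI impI)
        fix z s assume "0 < s" "s < 1 / Suc m" "dist z x < s"
        then have "\<not> a < avg M (ball z s) f" using no m by (meson less_trans)
        then show "avg M (ball z s) f \<le> real_of_rat p" using p by simp
      qed (use q n in auto)
      moreover have "p < q" using q by (simp add: of_rat_less)
      ultimately show False using elim by blast
    qed
  qed
qed

section \<open>Exponential decay for local maximal functions\<close>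

definition mean_oscillation_le :: "('a \<Rightarrow> real) \<Rightarrow> real \<Rightarrow> bool" where
  "mean_oscillation_le g N \<longleftrightarrow>
     (\<forall>x r. 0 < r \<longrightarrow> avg M (ball x r) (\<lambda>y. \<bar>g y - avg M (ball x r) g\<bar>) \<le> N)"

lemma avg_diff_le_mean_oscillation:
  assumes g: "g \<in> L1_loc M" and osc: "mean_oscillation_le g N"
    and r: "0 < s" "0 < r" and sub: "ball z s \<subseteq> ball x r"
    and le: "measure M (ball x r) \<le> c * measure M (ball z s)"
  shows "\<bar>avg M (ball z s) g - avg M (ball x r) g\<bar> \<le> c * N"
proof -
  have "\<bar>avg M (ball z s) g - avg M (ball x r) g\<bar>
      \<le> c * avg M (ball x r) (\<lambda>y. \<bar>g y - avg M (ball x r) g\<bar>)"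
    by (rule abs_avg_diff_superset_le) (use assms in \<open>auto intro: L1_loc_set_integrable measure_ball_pos\<close>)
  also have "\<dots> \<le> c * N"
  proof (rule mult_left_mono)
    show "0 \<le> c"
      using le measure_ball_pos[OF r(1), of z] measure_ball_pos[OF r(2), of x]
      by (smt (verit) mult_nonpos_nonneg)
  qed (use osc r in \<open>auto simp: mean_oscillation_le_def\<close>)
  finally show ?thesis .
qed

text \<open>
  A superlevel set of the local maximal function, whose supremum runs over the balls of radius at
  most \<open>r\<close>, at height \<open>t\<close> above the average over \<open>ball x r\<close>.
\<close>

definition upper_level :: "('a \<Rightarrow> real) \<Rightarrow> 'a \<Rightarrow> real \<Rightarrow> real \<Rightarrow> 'a set" where
  "upper_level g x r t = {y \<in> ball x r. \<exists>z s. 0 < s \<and> s \<le> r \<and> dist z y < s \<and>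
     avg M (ball x r) g + t < avg M (ball z s) g}"

lemma upper_level_in_sets [measurable]: "upper_level g x r t \<in> sets M"
proof -
  have "upper_level g x r t = ball x r \<inter>
      (\<Union>(z, s)\<in>{(z, s). 0 < s \<and> s \<le> r \<and> avg M (ball x r) g + t < avg M (ball z s) g}. ball z s)"
    by (auto simp: upper_level_def) blast
  also have "open \<dots>" by (intro open_Int open_ball open_UN) auto
  finally show ?thesis by (rule open_in_sets)
qed

text \<open>
  Balls of radius at most \<open>r\<close> that meet \<open>ball x r\<close> lie in the ball of radius \<open>4 * r\<close>; this bounds the
  mass of \<open>\<bar>g - g_B\<bar>\<close> that is available to a disjoint family of them.
\<close>

lemma emeasure_oscillation_le:
  assumes g: "g \<in> L1_loc M" and osc: "mean_oscillation_le g N" and r: "0 < r"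
  shows "emeasure (density M (\<lambda>y. ennreal \<bar>g y - avg M (ball x r) g\<bar>)) (ball x (4 * r))
    \<le> ennreal (2 * A ^ 4 * N * measure M (ball x r))"
proof -
  note [measurable] = L1_loc_measurable[OF g]
  let ?b = "avg M (ball x r) g" and ?Q = "ball x (4 * r)"
  let ?q = "avg M ?Q g"
  have m4: "measure M ?Q \<le> A ^ 2 * measure M (ball x r)"
    by (rule measure_ball_le) (use r in auto)
  have pos: "0 < measure M ?Q" using r by (intro measure_ball_pos) simp
  have int: "set_integrable M ?Q (\<lambda>y. \<bar>g y - c\<bar>)" for c
    by (intro set_integrable_abs set_integral_diff L1_loc_set_integrable g set_integrable_const ball_fmeasurable)
  have N0: "0 \<le> N"
  proof -
    have "0 \<le> avg M (ball x r) (\<lambda>y. \<bar>g y - avg M (ball x r) g\<bar>)"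
      by (simp add: avg_def set_lebesgue_integral_def)
    also have "\<dots> \<le> N" using osc r by (simp add: mean_oscillation_le_def)
    finally show ?thesis .
  qed
  have d: "\<bar>?b - ?q\<bar> \<le> A ^ 2 * N"
    by (rule avg_diff_le_mean_oscillation[OF g osc]) (use r m4 in auto)
  have "avg M ?Q (\<lambda>y. \<bar>g y - ?b\<bar>) \<le> avg M ?Q (\<lambda>y. \<bar>g y - ?q\<bar> - (- \<bar>?b - ?q\<bar>))"
    by (rule avg_mono_AE) (auto intro!: int set_integral_diff set_integrable_const)
  also have "\<dots> = avg M ?Q (\<lambda>y. \<bar>g y - ?q\<bar>) + \<bar>?b - ?q\<bar>"
    by (subst avg_diff_const) (auto intro: int pos)
  also have "\<dots> \<le> N + A ^ 2 * N"
    using osc r d by (intro add_mono) (auto simp: mean_oscillation_le_def)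
  also have "\<dots> \<le> 2 * A ^ 2 * N"
    using A_power_ge_1[of 2] N0 mult_right_mono[of 1 "A ^ 2" N] by (simp add: mult.commute)
  finally have "(LINT y:?Q|M. \<bar>g y - ?b\<bar>) \<le> 2 * A ^ 2 * N * measure M ?Q"
    using pos by (simp add: avg_def pos_divide_le_eq)
  also have "\<dots> \<le> 2 * A ^ 2 * N * (A ^ 2 * measure M (ball x r))"
    using m4 N0 A_ge_1 by (intro mult_left_mono) auto
  finally have le: "(LINT y:?Q|M. \<bar>g y - ?b\<bar>) \<le> 2 * A ^ 4 * N * measure M (ball x r)"
    by (simp add: power_add[of A 2 2, simplified] mult_ac)
  have "emeasure (density M (\<lambda>y. ennreal \<bar>g y - ?b\<bar>)) ?Q
      = (\<integral>\<^sup>+y. ennreal (indicator ?Q y * \<bar>g y - ?b\<bar>) \<partial>M)"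
    by (subst emeasure_density) (auto intro!: nn_integral_cong simp: indicator_def)
  also have "\<dots> = ennreal (LINT y:?Q|M. \<bar>g y - ?b\<bar>)"
    using int[of ?b] unfolding set_lebesgue_integral_def set_integrable_def
    by (subst nn_integral_eq_integral) auto
  finally show ?thesis using le by (simp add: ennreal_leI)
qed

text \<open>
  The summand \<open>4 * A ^ 7\<close> is the height at which the stopping balls are selected, chosen so that the
  measure of the level set is halved; \<open>2 * A ^ 4\<close> pays for the passage from a ball of radius \<open>r\<close> to a
  comparable one nearby.
\<close>

definition JN_const :: real where "JN_const = 4 * A ^ 7 + 2 * A ^ 4"

text \<open>
  Let \<open>B = ball x r\<close>. Each point \<open>y\<close> of the higher level set lies in balls on which \<open>g\<close> has average
  above \<open>g_B + K0 * N\<close>, with \<open>K0 = 4 * A ^ 7\<close>; choose one whose radius is at least half the supremum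
  of such radii, and from the chosen balls a disjoint Vitali subfamily. By maximality the average of
  \<open>g\<close> over the enlargement \<open>5C\<close> of a selected ball \<open>C\<close> is at most \<open>g_B + JN_const * N\<close>. So a ball
  through \<open>y\<close> with average above \<open>g_B + t + JN_const * N\<close> exceeds the average over \<open>5C\<close> by more than \<open>t\<close>, and
  \<open>y\<close> lies in the level set at height \<open>t\<close> of \<open>5C\<close>, to which the induction hypothesis applies. The
  selected balls have small total measure, because each carries a mean deviation from \<open>g_B\<close> of
  more than \<open>K0 * N\<close>.
  
  Since both hypothesis and conclusion speak of averages and not of values of \<open>g\<close>, this
  John-Nirenberg iteration controls the maximal function directly.
\<close>

lemma emeasure_upper_level_step:
  assumes g: "g \<in> L1_loc M" and osc: "mean_oscillation_le g N" and N: "0 < N"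
    and t: "0 \<le> t" and q: "0 \<le> q" and r: "0 < r"
    and IH: "\<And>z s. 0 < s \<Longrightarrow> emeasure M (upper_level g z s t) \<le> ennreal q * emeasure M (ball z s)"
  shows "emeasure M (upper_level g x r (t + JN_const * N)) \<le> ennreal (q / 2) * emeasure M (ball x r)"
proof -
  note [measurable] = L1_loc_measurable[OF g]
  let ?B = "ball x r"
  let ?b = "avg M ?B g"
  let ?E = "upper_level g x r (t + JN_const * N)"
  define K0 where "K0 = 4 * A ^ 7"
  have K0: "0 < K0" and KK0: "JN_const = K0 + 2 * A ^ 4" using A_ge_1 by (auto simp: K0_def JN_const_def)
  define \<nu> where "\<nu> = density M (\<lambda>y. ennreal \<bar>g y - ?b\<bar>)"
  have sets\<nu>: "sets \<nu> = sets M" by (simp add: \<nu>_def)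
  define F where "F = {(z, s). 0 < s \<and> s \<le> r \<and> ?b + K0 * N < avg M (ball z s) g}"
  define F' where "F' = {(z, s) \<in> F. \<exists>y \<in> ?B \<inter> ball z s. \<forall>z' s'. (z', s') \<in> F \<longrightarrow> y \<in> ball z' s' \<longrightarrow> s' \<le> 2 * s}"
  \<comment> \<open>A ball through \<open>y\<close> of nearly maximal radius: every ball of \<open>F\<close> through \<open>y\<close> has at most
    twice its radius.\<close>
  have near_max: "\<exists>z s. (z, s) \<in> F' \<and> y \<in> ball z s \<and> s0 \<le> 2 * s"
    if y: "y \<in> ?B" and zs: "(z0, s0) \<in> F" "y \<in> ball z0 s0" for y z0 s0
  proof -
    let ?S = "{s. \<exists>z. (z, s) \<in> F \<and> y \<in> ball z s}"
    have bd: "bdd_above ?S" by (rule bdd_aboveI[of _ r]) (auto simp: F_def)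
    have up: "s \<le> Sup ?S" if "s \<in> ?S" for s using that bd by (rule cSup_upper)
    have "0 < s0" using zs by (auto simp: F_def)
    moreover have "s0 \<le> Sup ?S" by (rule up) (use zs in blast)
    ultimately have "Sup ?S / 2 < Sup ?S" by simp
    then obtain s where s: "s \<in> ?S" "Sup ?S / 2 < s"
      using less_cSup_iff[of ?S "Sup ?S / 2"] bd zs by blast
    then obtain z where z: "(z, s) \<in> F" "y \<in> ball z s" by blast
    have *: "s' \<le> 2 * s" if "(z', s') \<in> F" "y \<in> ball z' s'" for z' s'
    proof -
      have "s' \<in> ?S" using that by blast
      then show ?thesis using up[of s'] s(2) by linarith
    qed
    then have "(z, s) \<in> F'" using z y unfolding F'_def by blast
    then show ?thesis using z * zs by blast
  qed
  have F'_near: "dist x z + s < 2 * r + s" if "(z, s) \<in> F'" for z s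
  proof -
    obtain y where y: "y \<in> ?B" "y \<in> ball z s" and "s \<le> r"
      using \<open>(z, s) \<in> F'\<close> by (auto simp: F'_def F_def)
    then show ?thesis using dist_triangle2[of x z y] by simp
  qed
  have F'_sub: "ball z s \<subseteq> ball x (4 * r)" if "(z, s) \<in> F'" for z s
  proof
    fix p assume "p \<in> ball z s"
    then show "p \<in> ball x (4 * r)"
      using F'_near[OF that] that dist_triangle[of x p z] by (auto simp: F'_def F_def)
  qed
  obtain G where G: "G \<subseteq> F'" "disjoint_family_on (\<lambda>(z, s). ball z s) G"
    "\<And>z s. (z, s) \<in> F' \<Longrightarrow> \<exists>w t. (w, t) \<in> G \<and> ball z s \<inter> ball w t \<noteq> {} \<and> s \<le> 2 * t"
    by (rule vitali_disjoint_subfamily[of F' r]) (auto simp: F'_def F_def)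
  have G_F': "(fst p, snd p) \<in> F'" if "p \<in> G" for p using G(1) that by auto
  have disj: "disjoint_family_on (\<lambda>p. ball (fst p) (snd p)) G"
    using G(2) by (simp add: case_prod_beta')
  have cG: "countable G"
    by (rule countable_disjoint_positive_measure[OF ball_fmeasurable _ _ _ disj, of x "4 * r"])
       (use F'_sub[OF G_F'] in \<open>auto intro!: measure_ball_pos dest!: G_F' simp: F'_def F_def\<close>)
  \<comment> \<open>If \<open>5 * s \<le> r\<close>, the enlargement violates the maximality of the radius unless its average is
    small. Otherwise it has radius comparable to \<open>r\<close> and is compared with \<open>ball x r\<close> by way of
    \<open>ball x (8 * r)\<close>, which contains both.\<close>
  have parent: "avg M (ball z (5 * s)) g \<le> ?b + JN_const * N" if zs: "(z, s) \<in> F'" for z s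
  proof (cases "5 * s \<le> r")
    case True
    obtain y where y: "y \<in> ball z s" "\<And>z' s'. (z', s') \<in> F \<Longrightarrow> y \<in> ball z' s' \<Longrightarrow> s' \<le> 2 * s"
      using zs unfolding F'_def by blast
    have s: "0 < s" using zs by (auto simp: F'_def F_def)
    have "(z, 5 * s) \<notin> F" using y(2)[of z "5 * s"] y(1) s by auto
    then have "avg M (ball z (5 * s)) g \<le> ?b + K0 * N" using True s by (simp add: F_def)
    moreover have "0 \<le> 2 * A ^ 4 * N" using N A_ge_1 by simp
    ultimately show ?thesis unfolding KK0 distrib_right by linarith
  next
    case False
    have s: "0 < s" "s \<le> r" using zs by (auto simp: F'_def F_def)
    let ?Q = "ball x (8 * r)"
    have d: "dist x z < 2 * r" using F'_near[OF zs] by simp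
    have "\<bar>avg M (ball z (5 * s)) g - avg M ?Q g\<bar> \<le> A ^ 4 * N"
    proof (rule avg_diff_le_mean_oscillation[OF g osc])
      show "ball z (5 * s) \<subseteq> ?Q"
      proof
        fix p assume "p \<in> ball z (5 * s)"
        then show "p \<in> ?Q" using s d dist_triangle[of x p z] by simp
      qed
      show "measure M ?Q \<le> A ^ 4 * measure M (ball z (5 * s))"
        by (rule measure_ball_le) (use s d False in \<open>auto simp: dist_commute\<close>)
    qed (use s r in auto)
    moreover have "\<bar>?b - avg M ?Q g\<bar> \<le> A ^ 3 * N"
      by (rule avg_diff_le_mean_oscillation[OF g osc]) (use r measure_ball_le[of r x x "8 * r" 3] in auto)
    moreover have "A ^ 3 * N \<le> A ^ 4 * N"
      using N A_ge_1 by (intro mult_right_mono power_increasing) auto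
    ultimately have "avg M (ball z (5 * s)) g \<le> ?b + 2 * A ^ 4 * N" by linarith
    moreover have "0 \<le> K0 * N" using N K0 by simp
    ultimately show ?thesis unfolding KK0 distrib_right by linarith
  qed
  have "?E \<subseteq> (\<Union>p\<in>G. upper_level g (fst p) (5 * snd p) t)"
  proof
    fix y assume "y \<in> ?E"
    then obtain z s where y: "y \<in> ?B" and zs: "0 < s" "s \<le> r" "dist z y < s"
      and big: "?b + (t + JN_const * N) < avg M (ball z s) g"
      by (auto simp: upper_level_def)
    \<comment> \<open>The large ball itself belongs to \<open>F\<close>, so the nearly maximal one has at least half its radius.\<close>
    have "K0 * N \<le> t + JN_const * N" using t N A_ge_1 by (simp add: KK0 distrib_right)
    then have "(z, s) \<in> F" using zs big by (simp add: F_def)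
    then obtain z1 s1 where zs1: "(z1, s1) \<in> F'" "y \<in> ball z1 s1" "s \<le> 2 * s1"
      using near_max[OF y] zs by fastforce
    then obtain w u where wu: "(w, u) \<in> G" "ball z1 s1 \<inter> ball w u \<noteq> {}" "s1 \<le> 2 * u" using G(3) by blast
    have "y \<in> ball w (5 * u)" using ball_subset_enlarged[OF wu(2,3)] zs1 by blast
    moreover have "0 < u" using G_F'[OF wu(1)] by (auto simp: F'_def F_def)
    then have "s \<le> 5 * u" using zs1 wu by simp
    moreover have "avg M (ball w (5 * u)) g + t < avg M (ball z s) g"
      using parent[of w u] G(1) wu(1) big by force
    ultimately have "y \<in> upper_level g w (5 * u) t" using zs unfolding upper_level_def by blast
    then show "y \<in> (\<Union>p\<in>G. upper_level g (fst p) (5 * snd p) t)" using wu(1) by force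
  qed
  then have "emeasure M ?E \<le> emeasure M (\<Union>p\<in>G. upper_level g (fst p) (5 * snd p) t)"
    by (rule emeasure_mono) (intro sets.countable_UN'' cG upper_level_in_sets)
  also have "\<dots> \<le> ennreal (q * A ^ 3) * emeasure M (\<Union>p\<in>G. ball (fst p) (snd p))"
  proof (rule emeasure_UN_le_disjoint_UN[OF cG _ _ disj])
    fix p assume "p \<in> G"
    obtain z s where p: "p = (z, s)" by fastforce
    have s: "0 < s" using G_F'[OF \<open>p \<in> G\<close>] by (auto simp: F'_def F_def p)
    have "emeasure M (upper_level g z (5 * s) t) \<le> ennreal q * emeasure M (ball z (5 * s))"
      by (rule IH) (use s in simp)
    also have "\<dots> \<le> ennreal q * ennreal (A ^ 3 * measure M (ball z s))"
      unfolding emeasure_ball_eq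
      by (intro mult_left_mono ennreal_leI measure_ball_le) (use s in auto)
    also have "\<dots> = ennreal (q * A ^ 3) * emeasure M (ball z s)"
      using q A_ge_1 by (simp add: emeasure_ball_eq ennreal_mult mult.assoc)
    finally show "emeasure M (upper_level g (fst p) (5 * snd p) t) \<le> ennreal (q * A ^ 3) * emeasure M (ball (fst p) (snd p))"
      by (simp add: p)
  qed auto
  \<comment> \<open>Chebyshev's inequality, ball by ball, for the selected balls.\<close>
  also have "emeasure M (\<Union>p\<in>G. ball (fst p) (snd p)) \<le> ennreal (1 / (K0 * N)) * emeasure \<nu> (\<Union>p\<in>G. ball (fst p) (snd p))"
  proof (rule emeasure_UN_le_disjoint_UN[OF cG _ _ disj])
    fix p assume "p \<in> G"
    obtain z s where p: "p = (z, s)" by fastforce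
    let ?C = "ball z s"
    have s: "0 < s" and big: "?b + K0 * N < avg M ?C g"
      using G_F'[OF \<open>p \<in> G\<close>] by (auto simp: F'_def F_def p)
    have int: "set_integrable M ?C (\<lambda>y. \<bar>g y - ?b\<bar>)"
      by (intro set_integrable_abs set_integral_diff L1_loc_set_integrable g set_integrable_const ball_fmeasurable)
    have "K0 * N \<le> \<bar>avg M ?C g - ?b\<bar>" using big by linarith
    also have "\<dots> \<le> avg M ?C (\<lambda>y. \<bar>g y - ?b\<bar>)"
      by (rule abs_avg_diff_le) (auto intro: L1_loc_set_integrable g measure_ball_pos s)
    finally have "measure M ?C \<le> 1 / (K0 * N) * (LINT y:?C|M. \<bar>g y - ?b\<bar>)"
      using K0 N measure_ball_pos[OF s, of z] by (simp add: avg_def field_simps)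
    then have "emeasure M ?C \<le> ennreal (1 / (K0 * N) * (LINT y:?C|M. \<bar>g y - ?b\<bar>))"
      unfolding emeasure_ball_eq by (rule ennreal_leI)
    also have "\<dots> = ennreal (1 / (K0 * N)) * ennreal (LINT y:?C|M. \<bar>g y - ?b\<bar>)"
      using K0 N by (subst ennreal_mult) (auto simp: set_lebesgue_integral_def)
    also have "ennreal (LINT y:?C|M. \<bar>g y - ?b\<bar>) = (\<integral>\<^sup>+y. ennreal (indicator ?C y * \<bar>g y - ?b\<bar>) \<partial>M)"
      using int unfolding set_lebesgue_integral_def set_integrable_def
      by (subst nn_integral_eq_integral) auto
    also have "\<dots> = emeasure \<nu> ?C"
      unfolding \<nu>_def by (subst emeasure_density) (auto intro!: nn_integral_cong simp: indicator_def)
    finally show "emeasure M (ball (fst p) (snd p)) \<le> ennreal (1 / (K0 * N)) * emeasure \<nu> (ball (fst p) (snd p))"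
      by (simp add: p)
  qed (auto simp: sets\<nu>)
  also have "emeasure \<nu> (\<Union>p\<in>G. ball (fst p) (snd p)) \<le> emeasure \<nu> (ball x (4 * r))"
    by (rule emeasure_mono) (use F'_sub[OF G_F'] in \<open>auto simp: sets\<nu>\<close>)
  also have "\<dots> \<le> ennreal (2 * A ^ 4 * N * measure M ?B)"
    unfolding \<nu>_def by (rule emeasure_oscillation_le[OF g osc r])
  finally have "emeasure M ?E \<le> ennreal (q * A ^ 3) * (ennreal (1 / (K0 * N)) * ennreal (2 * A ^ 4 * N * measure M ?B))"
    by (simp add: mult_left_mono)
  also have "\<dots> = ennreal (q * A ^ 3 * (1 / (K0 * N) * (2 * A ^ 4 * N * measure M ?B)))"
    using q K0 N A_ge_1 by (simp add: ennreal_mult[symmetric])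
  also have "q * A ^ 3 * (1 / (K0 * N) * (2 * A ^ 4 * N * measure M ?B)) = q / 2 * measure M ?B"
    using N A_ge_1 by (simp add: K0_def field_simps power_add[symmetric])
  also have "ennreal \<dots> = ennreal (q / 2) * emeasure M ?B"
    using q by (simp add: emeasure_ball_eq ennreal_mult[symmetric])
  finally show ?thesis .
qed

lemma emeasure_upper_level_le:
  assumes g: "g \<in> L1_loc M" and osc: "mean_oscillation_le g N" and N: "0 < N" and r: "0 < r"
  shows "emeasure M (upper_level g x r (real n * (JN_const * N))) \<le> ennreal ((1 / 2) ^ n) * emeasure M (ball x r)"
  using r
proof (induction n arbitrary: x r)
  case 0
  show ?case by (auto intro!: emeasure_mono simp: upper_level_def)
next
  case (Suc n)
  have "0 \<le> JN_const" using A_ge_1 by (simp add: JN_const_def)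
  then have "emeasure M (upper_level g x r (real n * (JN_const * N) + JN_const * N)) \<le> ennreal ((1 / 2) ^ n / 2) * emeasure M (ball x r)"
    using N Suc by (intro emeasure_upper_level_step[OF g osc N]) auto
  then show ?case by (simp add: algebra_simps)
qed


text \<open>
  As \<open>ennreal\<close> sends negative numbers to 0, this is the positive part of the local maximal function
  minus the average over \<open>ball x r\<close>.
\<close>

definition upper_excess :: "('a \<Rightarrow> real) \<Rightarrow> 'a \<Rightarrow> real \<Rightarrow> 'a \<Rightarrow> ennreal" where
  "upper_excess g x r y = (SUP (z, s)\<in>{(z, s). 0 < s \<and> s \<le> r \<and> dist z y < s}.
     ennreal (avg M (ball z s) g - avg M (ball x r) g))"

lemma upper_excess_measurable [measurable]: "upper_excess g x r \<in> borel_measurable M"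
proof (rule borel_measurableI_greater)
  fix a
  have "{y \<in> space M. a < upper_excess g x r y} =
    (\<Union>(z, s)\<in>{(z, s). 0 < s \<and> s \<le> r \<and> a < ennreal (avg M (ball z s) g - avg M (ball x r) g)}. ball z s)"
    by (auto simp: upper_excess_def less_SUP_iff) blast+
  also have "open \<dots>" by (intro open_UN) auto
  finally show "{y \<in> space M. a < upper_excess g x r y} \<in> sets M" by (rule open_in_sets)
qed

lemma avg_le_upper_excess:
  assumes "0 < s" "s \<le> r" "dist z y < s"
  shows "ennreal (avg M (ball z s) g - avg M (ball x r) g) \<le> upper_excess g x r y"
  unfolding upper_excess_def by (rule SUP_upper2[of "(z, s)"]) (use assms in auto)

text \<open>
  Cut the range into steps of height \<open>JN_const * N\<close>: the excess is at most that height times the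
  number of level sets that contain the point, and the measures of the level sets form a geometric
  series.
\<close>

lemma nn_integral_upper_excess_le:
  assumes g: "g \<in> L1_loc M" and osc: "mean_oscillation_le g N" and N: "0 < N" and r: "0 < r"
  shows "(\<integral>\<^sup>+y\<in>ball x r. upper_excess g x r y \<partial>M) \<le> ennreal (2 * JN_const * N) * emeasure M (ball x r)"
proof -
  define k where "k = JN_const * N"
  have k: "0 < k" using A_ge_1 N by (simp add: k_def JN_const_def add_pos_pos)
  let ?B = "ball x r" and ?L = "\<lambda>n::nat. upper_level g x r (real n * k)"
  have pt: "upper_excess g x r y * indicator ?B y \<le> (\<Sum>n. ennreal k * indicator (?L n) y)" for y
  proof (cases "y \<in> ?B")
    case True
    have "ennreal (avg M (ball z s) g - avg M ?B g) \<le> (\<Sum>n. ennreal k * indicator (?L n) y)"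
      if zs: "0 < s" "s \<le> r" "dist z y < s" for z s
    proof -
      define v where "v = avg M (ball z s) g - avg M ?B g"
      define m where "m = nat \<lceil>v / k\<rceil>"
      have "y \<in> ?L n" if "n < m" for n
      proof -
        have "real n < v / k" using that unfolding m_def by linarith
        then have "real n * k < v" using k by (simp add: pos_less_divide_eq)
        then show ?thesis using True zs unfolding upper_level_def v_def by fastforce
      qed
      then have "(\<Sum>n<m. ennreal k * indicator (?L n) y) = (\<Sum>n<m. ennreal k)" by (intro sum.cong) auto
      also have "\<dots> = ennreal (real m * k)"
        using k by (simp add: ennreal_of_nat_eq_real_of_nat ennreal_mult)
      finally have eq: "(\<Sum>n<m. ennreal k * indicator (?L n) y) = ennreal (real m * k)" .
      have "v / k \<le> real m" unfolding m_def by linarith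
      then have "v \<le> real m * k" using k by (simp add: pos_divide_le_eq)
      then have "ennreal v \<le> (\<Sum>n<m. ennreal k * indicator (?L n) y)"
        unfolding eq by (rule ennreal_leI)
      also have "\<dots> \<le> (\<Sum>n. ennreal k * indicator (?L n) y)" by (rule sum_le_suminf) auto
      finally show ?thesis by (simp add: v_def)
    qed
    then show ?thesis using True by (auto simp: upper_excess_def intro!: SUP_least)
  qed simp
  have "(\<integral>\<^sup>+y\<in>?B. upper_excess g x r y \<partial>M) \<le> (\<integral>\<^sup>+y. (\<Sum>n. ennreal k * indicator (?L n) y) \<partial>M)"
    by (rule nn_integral_mono) (rule pt)
  also have "\<dots> = (\<Sum>n. ennreal k * emeasure M (?L n))"
    by (subst nn_integral_suminf) (auto simp: nn_integral_cmult)
  also have "\<dots> \<le> (\<Sum>n. (ennreal k * emeasure M ?B) * ennreal ((1 / 2) ^ n))"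
  proof (rule suminf_le)
    fix n
    show "ennreal k * emeasure M (?L n) \<le> (ennreal k * emeasure M ?B) * ennreal ((1 / 2) ^ n)"
      using mult_left_mono[OF emeasure_upper_level_le[OF g osc N r, of x n], of "ennreal k"]
      by (simp add: k_def mult_ac)
  qed auto
  also have "\<dots> = (ennreal k * emeasure M ?B) * (\<Sum>n. ennreal ((1 / 2) ^ n))" by simp
  also have "(\<Sum>n. ennreal ((1 / 2) ^ n)) = ennreal 2"
    by (rule suminf_ennreal_eq) (use geometric_sums[of "1 / 2 :: real"] in auto)
  also have "(ennreal k * emeasure M ?B) * ennreal 2 = ennreal (2 * JN_const * N) * emeasure M ?B"
  proof -
    have "ennreal (2 * JN_const * N) = ennreal k * ennreal 2"
      using k by (subst ennreal_mult[symmetric]) (auto simp: k_def mult_ac)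
    then show ?thesis by (simp add: mult_ac del: ennreal_numeral)
  qed
  finally show ?thesis .
qed

end

section \<open>Admissible functions and the norms of BMO and BLO\<close>

locale admissible_doubling_measure = doubling_measure M A
  for M :: "'a::metric_space measure" and A :: real +
  fixes \<rho> :: "'a \<Rightarrow> real" and C0 k0 :: real
  assumes rho_pos: "0 < \<rho> x" and C0_pos: "0 < C0" and k0_pos: "0 < k0"
    and rho_admissible: "1 / \<rho> x \<le> C0 * (1 / \<rho> y) * (1 + dist x y / \<rho> y) powr k0"
begin

text \<open>
  The purpose is that all sufficiently small balls through a given point, whatever their centres,
  are outside \<open>D_balls \<rho>\<close>.
\<close>

lemma rho_locally_bounded_below: "\<exists>\<delta>>0. \<delta> \<le> 1 \<and> (\<forall>z. dist z x < 1 \<longrightarrow> \<delta> \<le> \<rho> z)"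
proof -
  define c where "c = C0 * (1 / \<rho> x) * (1 + 1 / \<rho> x) powr k0"
  have "0 < 1 + 1 / \<rho> x" using rho_pos[of x] by (simp add: add_pos_pos)
  then have c: "0 < c" using rho_pos[of x] C0_pos by (simp add: c_def)
  have "1 / c \<le> \<rho> z" if "dist z x < 1" for z
  proof -
    have "(1 + dist z x / \<rho> x) powr k0 \<le> (1 + 1 / \<rho> x) powr k0"
      using that rho_pos[of x] k0_pos by (intro powr_mono2) (auto simp: divide_right_mono)
    then have "1 / \<rho> z \<le> c"
      unfolding c_def using rho_pos[of x] C0_pos
      by (intro order_trans[OF rho_admissible[of z x]] mult_left_mono) auto
    then show ?thesis using c rho_pos[of z] by (simp add: field_simps)
  qed
  then show ?thesis using c by (intro exI[of _ "min 1 (1 / c)"]) (auto intro: min.coboundedI2)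
qed

definition rho_steps :: nat where "rho_steps = nat \<lceil>C0 * 3 powr k0\<rceil>"

text \<open>
  A ball with centre \<open>z\<close> and radius below \<open>\<rho> z\<close> may meet a ball of \<open>D_balls \<rho>\<close> with centre \<open>x\<close> and smaller radius.
  This lemma shows that doubling its radius \<open>rho_steps\<close> times brings it into \<open>D_balls \<rho>\<close>.
\<close>

lemma rho_le_nearby:
  assumes "dist x z \<le> 2 * \<rho> z"
  shows "\<rho> z \<le> 2 ^ rho_steps * \<rho> x"
proof -
  have "dist x z / \<rho> z \<le> 2" using assms rho_pos[of z] by (simp add: pos_divide_le_eq)
  then have "(1 + dist x z / \<rho> z) powr k0 \<le> 3 powr k0"
    using rho_pos[of z] k0_pos by (intro powr_mono2) auto
  then have "1 / \<rho> x \<le> C0 * (1 / \<rho> z) * 3 powr k0"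
    using rho_pos[of z] C0_pos
    by (intro order_trans[OF rho_admissible[of x z]] mult_left_mono) auto
  then have "\<rho> z \<le> (C0 * 3 powr k0) * \<rho> x"
    using rho_pos[of z] rho_pos[of x] by (simp add: field_simps)
  also have "C0 * 3 powr k0 \<le> real rho_steps" unfolding rho_steps_def by linarith
  also have "real rho_steps \<le> 2 ^ rho_steps" using of_nat_less_two_power[of rho_steps, where 'a = real] by simp
  finally show ?thesis using rho_pos[of x] by simp
qed

lemma nn_avg_eq_avg:
  assumes "set_integrable M (ball x r) u" "\<And>y. 0 \<le> u y" "0 < r"
  shows "nn_avg M (ball x r) (\<lambda>y. ennreal (u y)) = ennreal (avg M (ball x r) u)"
proof -
  have "(\<integral>\<^sup>+y\<in>ball x r. ennreal (u y) \<partial>M) = (\<integral>\<^sup>+y. ennreal (indicator (ball x r) y * u y) \<partial>M)"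
    by (intro nn_integral_cong) (auto simp: indicator_def)
  also have "\<dots> = ennreal (LINT y:ball x r|M. u y)"
    using assms unfolding set_integrable_def set_lebesgue_integral_def
    by (subst nn_integral_eq_integral) auto
  finally show ?thesis
    using assms measure_ball_pos[of r x]
    by (simp add: nn_avg_def avg_def emeasure_ball_eq divide_ennreal set_lebesgue_integral_def)
qed

lemma set_integrable_abs_diff:
  "f \<in> L1_loc M \<Longrightarrow> set_integrable M (ball x r) (\<lambda>y. \<bar>f y - c\<bar>)"
  by (intro set_integrable_abs set_integral_diff L1_loc_set_integrable set_integrable_const ball_fmeasurable)

lemma nn_avg_abs_diff:
  "f \<in> L1_loc M \<Longrightarrow> 0 < r \<Longrightarrow>
    nn_avg M (ball x r) (\<lambda>y. ennreal \<bar>f y - c\<bar>) = ennreal (avg M (ball x r) (\<lambda>y. \<bar>f y - c\<bar>))"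
  by (intro nn_avg_eq_avg set_integrable_abs_diff) auto

lemma nn_avg_abs:
  "f \<in> L1_loc M \<Longrightarrow> 0 < r \<Longrightarrow>
    nn_avg M (ball x r) (\<lambda>y. ennreal \<bar>f y\<bar>) = ennreal (avg M (ball x r) (\<lambda>y. \<bar>f y\<bar>))"
  using nn_avg_abs_diff[of f r x 0] by simp

lemma set_integrable_abs_L1_loc: "f \<in> L1_loc M \<Longrightarrow> set_integrable M (ball x r) (\<lambda>y. \<bar>f y\<bar>)"
  using set_integrable_abs_diff[of f x r 0] by simp

lemma BMO_norm_leI:
  assumes f: "f \<in> L1_loc M"
    and "\<And>x r. 0 < r \<Longrightarrow> r < \<rho> x \<Longrightarrow> avg M (ball x r) (\<lambda>y. \<bar>f y - avg M (ball x r) f\<bar>) \<le> a"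
    and "\<And>x r. \<rho> x \<le> r \<Longrightarrow> avg M (ball x r) (\<lambda>y. \<bar>f y\<bar>) \<le> b"
    and "0 \<le> a" "0 \<le> b"
  shows "BMO_norm M \<rho> f \<le> ennreal (a + b)"
  unfolding BMO_norm_def ennreal_plus[OF assms(4,5)]
  by (intro add_mono SUP_least)
     (auto simp: balls_def D_balls_def nn_avg_abs_diff[OF f] nn_avg_abs[OF f] intro!: ennreal_leI assms(2,3))

lemma BMO_normD:
  assumes f: "f \<in> L1_loc M" and le: "BMO_norm M \<rho> f \<le> ennreal N" and N: "0 \<le> N"
  shows "0 < r \<Longrightarrow> r < \<rho> x \<Longrightarrow> avg M (ball x r) (\<lambda>y. \<bar>f y - avg M (ball x r) f\<bar>) \<le> N"
    and "\<rho> x \<le> r \<Longrightarrow> avg M (ball x r) (\<lambda>y. \<bar>f y\<bar>) \<le> N"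
proof -
  assume r: "0 < r" "r < \<rho> x"
  have nn: "nn_avg M (ball x r) (\<lambda>y. ennreal \<bar>f y - avg M (ball x r) f\<bar>) \<le> BMO_norm M \<rho> f"
    unfolding BMO_norm_def
    by (rule add_increasing2) (use r in \<open>auto simp: balls_def D_balls_def intro!: SUP_upper2[of "(x, r)"]\<close>)
  then show "avg M (ball x r) (\<lambda>y. \<bar>f y - avg M (ball x r) f\<bar>) \<le> N"
    using order_trans[OF nn le] N by (simp add: nn_avg_abs_diff[OF f r(1)])
next
  assume r: "\<rho> x \<le> r"
  then have "0 < r" using rho_pos[of x] by simp
  have nn: "nn_avg M (ball x r) (\<lambda>y. ennreal \<bar>f y\<bar>) \<le> BMO_norm M \<rho> f"
    unfolding BMO_norm_def
    by (rule add_increasing) (use r \<open>0 < r\<close> in \<open>auto simp: balls_def D_balls_def intro!: SUP_upper2[of "(x, r)"]\<close>)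
  then show "avg M (ball x r) (\<lambda>y. \<bar>f y\<bar>) \<le> N"
    using order_trans[OF nn le] N by (simp add: nn_avg_abs[OF f \<open>0 < r\<close>])
qed

text \<open>
  On balls of \<open>D_balls \<rho>\<close> the mean of \<open>\<bar>f\<bar>\<close> is controlled, and twice that mean bounds the mean
  oscillation; so \<open>f\<close> is of bounded mean oscillation over all balls.
\<close>

lemma mean_oscillation_le_of_BMO:
  assumes f: "f \<in> L1_loc M" and le: "BMO_norm M \<rho> f \<le> ennreal N" and N: "0 \<le> N"
  shows "mean_oscillation_le f (2 * N)"
  unfolding mean_oscillation_le_def
proof (intro allI impI)
  fix x :: 'a and r :: real assume r: "0 < r"
  let ?B = "ball x r"
  show "avg M ?B (\<lambda>y. \<bar>f y - avg M ?B f\<bar>) \<le> 2 * N"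
  proof (cases "r < \<rho> x")
    case True
    then show ?thesis using BMO_normD(1)[OF f le N r] N by fastforce
  next
    case False
    then have *: "avg M ?B (\<lambda>y. \<bar>f y\<bar>) \<le> N" by (intro BMO_normD(2)[OF f le N]) simp
    have "avg M ?B (\<lambda>y. \<bar>f y - avg M ?B f\<bar>) \<le> avg M ?B (\<lambda>y. \<bar>f y\<bar> - (- \<bar>avg M ?B f\<bar>))"
      by (rule avg_mono_AE) (auto intro!: set_integrable_abs_diff[OF f] set_integral_diff set_integrable_abs_L1_loc[OF f] set_integrable_const)
    also have "\<dots> = avg M ?B (\<lambda>y. \<bar>f y\<bar>) + \<bar>avg M ?B f\<bar>"
      by (subst avg_diff_const) (auto intro: set_integrable_abs_L1_loc f measure_ball_pos r)
    also have "\<bar>avg M ?B f\<bar> \<le> avg M ?B (\<lambda>y. \<bar>f y\<bar>)"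
      using abs_avg_diff_le[OF L1_loc_set_integrable[OF f] ball_fmeasurable measure_ball_pos[OF r], of x 0] by simp
    finally show ?thesis using * by simp
  qed
qed

text \<open>
  A finite norm forces the essential infimum to be a real number \<open>c\<close>, because the mean of the constant
  \<open>\<infinity>\<close> over a ball is infinite. The bound is stated for \<open>\<bar>f - c\<bar>\<close>, which is almost everywhere
  \<open>f - c\<close>, since in this form it controls both \<open>f_B - c\<close> and the mean oscillation.
\<close>

lemma BLO_normD:
  assumes f: "f \<in> L1_loc M" and le: "BLO_norm M \<rho> f \<le> ennreal N" and N: "0 \<le> N"
  shows "0 < r \<Longrightarrow> r < \<rho> x \<Longrightarrow>
      \<exists>c. (AE y in M. y \<in> ball x r \<longrightarrow> c \<le> f y) \<and> avg M (ball x r) (\<lambda>y. \<bar>f y - c\<bar>) \<le> N"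
    and "\<rho> x \<le> r \<Longrightarrow> avg M (ball x r) (\<lambda>y. \<bar>f y\<bar>) \<le> N"
proof -
  assume r: "0 < r" "r < \<rho> x"
  let ?B = "ball x r"
  define e where "e = ess_inf_on M ?B f"
  have "nn_avg M ?B (\<lambda>y. e2ennreal (ereal (f y) - e)) \<le> BLO_norm M \<rho> f"
    unfolding BLO_norm_def e_def
    by (rule add_increasing2) (use r in \<open>auto simp: balls_def D_balls_def intro!: SUP_upper2[of "(x, r)"]\<close>)
  then have leN: "nn_avg M ?B (\<lambda>y. e2ennreal (ereal (f y) - e)) \<le> ennreal N" using le by (rule order_trans)
  have "AE y in restrict_space M ?B. - ereal (f y) \<le> - e"
    using esssup_AE[of "\<lambda>y. - ereal (f y)" "restrict_space M ?B"] by (simp add: e_def ess_inf_on_def)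
  then have ge: "AE y in M. y \<in> ?B \<longrightarrow> e \<le> ereal (f y)"
    by (subst (asm) AE_restrict_space_iff) (auto simp only: ereal_minus_le_minus ball_in_sets space_eq_UNIV Int_UNIV_right)
  have "e \<noteq> \<infinity>"
  proof
    assume "e = \<infinity>"
    then have "AE y in M. y \<notin> ?B" using ge by auto
    then have "?B \<in> null_sets M" by (subst AE_iff_null_sets) auto
    then have "emeasure M ?B = 0" by blast
    then show False using emeasure_ball_pos[OF r(1), of x] by simp
  qed
  moreover have "e \<noteq> - \<infinity>"
  proof
    assume "e = - \<infinity>"
    then have "nn_avg M ?B (\<lambda>y. e2ennreal (ereal (f y) - e)) = \<infinity> * emeasure M ?B / emeasure M ?B"
      by (simp add: nn_avg_def nn_integral_cmult)
    also have "\<dots> = \<infinity>"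
      using emeasure_ball_pos[OF r(1), of x] emeasure_ball_finite[OF r(1), of x]
      by (subst mult_divide_eq_ennreal) auto
    finally show False using leN by (simp add: top_unique)
  qed
  ultimately obtain c where c: "e = ereal c" by (cases e) auto
  have AEc: "AE y in M. y \<in> ?B \<longrightarrow> c \<le> f y" using ge by (simp add: c)
  have "nn_avg M ?B (\<lambda>y. e2ennreal (ereal (f y) - e)) = nn_avg M ?B (\<lambda>y. ennreal \<bar>f y - c\<bar>)"
    unfolding nn_avg_def c using AEc
    by (intro arg_cong[where f = "\<lambda>t. t / emeasure M ?B"] nn_integral_cong_AE)
       (auto elim!: eventually_mono simp: indicator_def ennreal.rep_eq e2ennreal_ereal)
  then have "avg M ?B (\<lambda>y. \<bar>f y - c\<bar>) \<le> N"
    using leN N by (simp add: nn_avg_abs_diff[OF f r(1)])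
  then show "\<exists>c. (AE y in M. y \<in> ?B \<longrightarrow> c \<le> f y) \<and> avg M ?B (\<lambda>y. \<bar>f y - c\<bar>) \<le> N"
    using AEc by blast
next
  assume r: "\<rho> x \<le> r"
  then have "0 < r" using rho_pos[of x] by simp
  have nn: "nn_avg M (ball x r) (\<lambda>y. ennreal \<bar>f y\<bar>) \<le> BLO_norm M \<rho> f"
    unfolding BLO_norm_def
    by (rule add_increasing) (use r \<open>0 < r\<close> in \<open>auto simp: balls_def D_balls_def intro!: SUP_upper2[of "(x, r)"]\<close>)
  then show "avg M (ball x r) (\<lambda>y. \<bar>f y\<bar>) \<le> N"
    using order_trans[OF nn le] N by (simp add: nn_avg_abs[OF f \<open>0 < r\<close>])
qed

lemma BMO_norm_le_of_BLO:
  assumes f: "f \<in> L1_loc M" and le: "BLO_norm M \<rho> f \<le> ennreal N" and N: "0 \<le> N"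
  shows "BMO_norm M \<rho> f \<le> ennreal (2 * N + N)"
proof (rule BMO_norm_leI[OF f])
  fix x r assume r: "0 < r" "r < \<rho> x"
  let ?B = "ball x r"
  let ?b = "avg M ?B f"
  obtain c where c: "avg M ?B (\<lambda>y. \<bar>f y - c\<bar>) \<le> N" using BLO_normD(1)[OF f le N r] by blast
  have "avg M ?B (\<lambda>y. \<bar>f y - ?b\<bar>) \<le> avg M ?B (\<lambda>y. \<bar>f y - c\<bar> - (- \<bar>?b - c\<bar>))"
    by (rule avg_mono_AE) (auto intro!: set_integrable_abs_diff set_integral_diff set_integrable_const f)
  also have "\<dots> = avg M ?B (\<lambda>y. \<bar>f y - c\<bar>) + \<bar>?b - c\<bar>"
    by (subst avg_diff_const) (auto intro: set_integrable_abs_diff f measure_ball_pos r)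
  also have "\<bar>?b - c\<bar> \<le> avg M ?B (\<lambda>y. \<bar>f y - c\<bar>)"
    by (intro abs_avg_diff_le L1_loc_set_integrable f ball_fmeasurable measure_ball_pos r)
  finally show "avg M ?B (\<lambda>y. \<bar>f y - ?b\<bar>) \<le> 2 * N" using c by simp
next
  fix x r assume "\<rho> x \<le> r"
  then show "avg M (ball x r) (\<lambda>y. \<bar>f y\<bar>) \<le> N" by (rule BLO_normD(2)[OF f le N])
qed (use N in auto)

section \<open>BLO functions differ from their maximal functions by bounded functions\<close>

lemma avg_le_M_rho:
  "0 < s \<Longrightarrow> s < \<rho> z \<Longrightarrow> dist z x < s \<Longrightarrow> ereal (avg M (ball z s) g) \<le> M_rho M \<rho> g x"
  unfolding M_rho_def by (rule SUP_upper2[of "(z, s)"]) (auto simp: balls_def D_balls_def)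

lemma M_rho_leI:
  "(\<And>z s. 0 < s \<Longrightarrow> s < \<rho> z \<Longrightarrow> dist z x < s \<Longrightarrow> ereal (avg M (ball z s) g) \<le> c) \<Longrightarrow> M_rho M \<rho> g x \<le> c"
  unfolding M_rho_def by (rule SUP_least) (auto simp: balls_def D_balls_def)

lemma M_rho_measurable [measurable]: "M_rho M \<rho> g \<in> borel_measurable M"
proof (rule borel_measurableI_greater)
  fix a
  have "{y \<in> space M. a < M_rho M \<rho> g y} =
    (\<Union>(z, s)\<in>{(z, s). 0 < s \<and> s < \<rho> z \<and> a < ereal (avg M (ball z s) g)}. ball z s)"
    by (auto simp: M_rho_def less_SUP_iff balls_def D_balls_def) (force simp: not_le)+
  also have "open \<dots>" by (intro open_UN) auto
  finally show "{y \<in> space M. a < M_rho M \<rho> g y} \<in> sets M" by (rule open_in_sets)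
qed

text \<open>
  Take \<open>x\<close> at which both \<open>f\<close> and \<open>- f\<close> satisfy the one-sided differentiation property. Small balls
  through \<open>x\<close> are outside \<open>D_balls \<rho>\<close> and have averages nearly as large as \<open>f x\<close>, whence the first inequality.
  If \<open>B\<close> is a ball through \<open>x\<close> outside \<open>D_balls \<rho>\<close>, then small balls through \<open>x\<close> lie in \<open>B\<close> and have averages
  that are not much larger than \<open>f x\<close> and not smaller than \<open>c\<close>, the essential infimum over \<open>B\<close>; so
  \<open>f_B \<le> c + N \<le> f x + N\<close>. The point here is that the exceptional null set does not depend on \<open>B\<close>.
\<close>

lemma M_rho_close_to_BLO:
  assumes f: "f \<in> L1_loc M" and le: "BLO_norm M \<rho> f \<le> ennreal N" and N: "0 \<le> N"
  shows "AE x in M. ereal (f x) \<le> M_rho M \<rho> f x \<and> M_rho M \<rho> f x \<le> ereal (f x + N)"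
  using AE_exists_small_ball_avg_greater[OF f] AE_exists_small_ball_avg_greater[OF L1_loc_uminus[OF f]]
proof eventually_elim
  case (elim x)
  have "ereal (f x) \<le> M_rho M \<rho> f x"
  proof (rule ereal_le_real)
    fix u assume u: "M_rho M \<rho> f x \<le> ereal u"
    obtain \<delta> where \<delta>: "0 < \<delta>" "\<delta> \<le> 1" "\<And>z. dist z x < 1 \<Longrightarrow> \<delta> \<le> \<rho> z"
      using rho_locally_bounded_below[of x] by blast
    have "f x \<le> u"
    proof (rule dense_le)
      fix a assume "a < f x"
      then obtain z s where zs: "0 < s" "s < \<delta>" "dist z x < s" "a < avg M (ball z s) f"
        using elim(1) \<delta>(1) by blast
      then have "s < \<rho> z" using \<delta>(2) \<delta>(3)[of z] by simp
      then have "ereal (avg M (ball z s) f) \<le> ereal u"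
        by (intro order_trans[OF avg_le_M_rho u] zs)
      then show "a \<le> u" using zs by simp
    qed
    then show "ereal (f x) \<le> ereal u" by simp
  qed
  moreover have "M_rho M \<rho> f x \<le> ereal (f x + N)"
  proof (rule M_rho_leI)
    fix z s assume s: "0 < s" "s < \<rho> z" and x: "dist z x < s"
    obtain c where c: "AE y in M. y \<in> ball z s \<longrightarrow> c \<le> f y"
      and cN: "avg M (ball z s) (\<lambda>y. \<bar>f y - c\<bar>) \<le> N"
      using BLO_normD(1)[OF f le N s] by blast
    have "c \<le> f x"
    proof (rule ccontr)
      assume "\<not> c \<le> f x"
      then have "- c < - f x" by simp
      moreover have "0 < (s - dist z x) / 2" using x by simp
      ultimately obtain w t where wt: "0 < t" "t < (s - dist z x) / 2" "dist w x < t"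
        "- c < avg M (ball w t) (\<lambda>y. - f y)"
        using elim(2) by blast
      have "ball w t \<subseteq> ball z s"
      proof
        fix p assume "p \<in> ball w t"
        then show "p \<in> ball z s"
          using wt dist_triangle[of z p x] dist_triangle[of x p w] by (simp add: dist_commute)
      qed
      then have "AE y in M. y \<in> ball w t \<longrightarrow> - f y \<le> - c" using c by (auto elim!: eventually_mono)
      then have "avg M (ball w t) (\<lambda>y. - f y) \<le> avg M (ball w t) (\<lambda>_. - c)"
        by (intro avg_mono_AE L1_loc_set_integrable L1_loc_uminus f set_integrable_const) auto
      also have "\<dots> = - c"
        using measure_ball_pos[OF wt(1), of w] by (simp add: avg_def set_lebesgue_integral_def)
      finally show False using wt by simp
    qed
    moreover have "\<bar>avg M (ball z s) f - c\<bar> \<le> avg M (ball z s) (\<lambda>y. \<bar>f y - c\<bar>)"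
      by (intro abs_avg_diff_le L1_loc_set_integrable f ball_fmeasurable measure_ball_pos s)
    ultimately show "ereal (avg M (ball z s) f) \<le> ereal (f x + N)" using cN by simp
  qed
  ultimately show ?case by blast
qed

lemma BLO_representation:
  assumes f: "f \<in> L1_loc M" and le: "BLO_norm M \<rho> f \<le> ennreal N" and N: "0 \<le> N"
  defines "h \<equiv> \<lambda>x. f x - real_of_ereal (M_rho M \<rho> f x)"
  shows "(f, h) \<in> representations M \<rho> f" and "BMO_norm M \<rho> f + Linf_norm M h \<le> ennreal (4 * N)"
proof -
  note [measurable] = L1_loc_measurable[OF f]
  have BMO: "BMO_norm M \<rho> f \<le> ennreal (2 * N + N)" by (rule BMO_norm_le_of_BLO[OF f le N])
  have meas[measurable]: "h \<in> borel_measurable M" unfolding h_def by measurable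
  have AEh: "AE x in M. ereal (f x) = M_rho M \<rho> f x + ereal (h x) \<and> \<bar>h x\<bar> \<le> N"
    using M_rho_close_to_BLO[OF f le N]
  proof eventually_elim
    case (elim x)
    then show ?case by (cases "M_rho M \<rho> f x") (auto simp: h_def)
  qed
  have Linf: "Linf_norm M h \<le> ennreal N"
    unfolding Linf_norm_def
  proof (rule esssup_I)
    show "AE x in M. ennreal \<bar>h x\<bar> \<le> ennreal N"
      using AEh by eventually_elim (auto intro: ennreal_leI)
  qed measurable
  show "(f, h) \<in> representations M \<rho> f"
    using AEh f meas BMO Linf
    by (auto simp: representations_def BMO_def Linf_def elim!: eventually_mono
        intro: le_less_trans[OF _ ennreal_less_top])
  have "BMO_norm M \<rho> f + Linf_norm M h \<le> ennreal (2 * N + N) + ennreal N"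
    by (intro add_mono BMO Linf)
  also have "\<dots> = ennreal (4 * N)" using N by (simp flip: ennreal_plus)
  finally show "BMO_norm M \<rho> f + Linf_norm M h \<le> ennreal (4 * N)" .
qed

section \<open>Maximal functions of BMO functions have bounded lower oscillation\<close>

lemma abs_avg_le_of_D_superset:
  assumes g: "g \<in> L1_loc M" and le: "BMO_norm M \<rho> g \<le> ennreal N" and N: "0 \<le> N"
    and s: "0 < s" and D: "\<rho> z \<le> 2 ^ k * s"
  shows "\<bar>avg M (ball z s) g\<bar> \<le> A ^ k * N"
proof -
  have "s \<le> 2 ^ k * s" using s by simp
  then have "\<bar>avg M (ball z s) g - 0\<bar> \<le> A ^ k * avg M (ball z (2 ^ k * s)) (\<lambda>y. \<bar>g y - 0\<bar>)"
    using s by (intro abs_avg_diff_superset_le L1_loc_set_integrable g doubling_power measure_ball_pos subset_ball) auto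
  also have "\<dots> \<le> A ^ k * N"
    using BMO_normD(2)[OF g le N D] A_ge_1 by (intro mult_left_mono) auto
  finally show ?thesis by simp
qed

text \<open>
  The ball with centre \<open>x\<close> and radius \<open>\<rho> x / 2\<close> is outside \<open>D_balls \<rho>\<close>, while its double belongs
  to \<open>D_balls \<rho>\<close>; so its average is admitted in the supremum and is at most \<open>A * N\<close> in absolute value.
\<close>

lemma M_rho_ge:
  assumes g: "g \<in> L1_loc M" and le: "BMO_norm M \<rho> g \<le> ennreal N" and N: "0 \<le> N"
  shows "ereal (- (A * N)) \<le> M_rho M \<rho> g x"
proof -
  have "\<bar>avg M (ball x (\<rho> x / 2)) g\<bar> \<le> A ^ 1 * N"
    by (rule abs_avg_le_of_D_superset[OF g le N]) (use rho_pos[of x] in auto)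
  then have "ereal (- (A * N)) \<le> ereal (avg M (ball x (\<rho> x / 2)) g)" by simp
  also have "\<dots> \<le> M_rho M \<rho> g x" by (rule avg_le_M_rho) (use rho_pos[of x] in auto)
  finally show ?thesis .
qed

text \<open>
  A ball through \<open>x\<close> of radius \<open>s \<le> r\<close> exceeds \<open>g_B\<close>, for \<open>B = ball x0 r\<close>, by at most \<open>t\<close>, and \<open>g_B\<close> is
  a lower bound of the maximal function on \<open>B\<close>. If \<open>s > r\<close>, the ball of radius \<open>4 * s\<close> contains \<open>y\<close>.
  When it is outside \<open>D_balls \<rho>\<close> its average is admitted at \<open>y\<close>; when it belongs to \<open>D_balls \<rho>\<close> the original average
  is at most a multiple of \<open>N\<close>, which is compared with the global lower bound at \<open>y\<close>.
\<close>

lemma M_rho_le_on_small_ball: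
  assumes g: "g \<in> L1_loc M" and le: "BMO_norm M \<rho> g \<le> ennreal N" and N: "0 \<le> N"
    and r: "0 < r" "r < \<rho> x0" and xy: "x \<in> ball x0 r" "y \<in> ball x0 r"
    and T: "upper_excess g x0 r x = ennreal t" "0 \<le> t"
  shows "M_rho M \<rho> g x \<le> M_rho M \<rho> g y + ereal (t + 2 * A ^ 2 * N)"
proof (rule M_rho_leI)
  fix z s assume s: "0 < s" "s < \<rho> z" and x: "dist z x < s"
  have AN: "0 \<le> 2 * A ^ 2 * N" using N by simp
  show "ereal (avg M (ball z s) g) \<le> M_rho M \<rho> g y + ereal (t + 2 * A ^ 2 * N)"
  proof (cases "s \<le> r")
    case True
    then have "ennreal (avg M (ball z s) g - avg M (ball x0 r) g) \<le> ennreal t"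
      using avg_le_upper_excess[OF s(1) True x, of g x0] T by simp
    then have "avg M (ball z s) g \<le> avg M (ball x0 r) g + (t + 2 * A ^ 2 * N)"
      using T(2) AN by (subst (asm) ennreal_le_iff) linarith+
    then have "ereal (avg M (ball z s) g) \<le> ereal (avg M (ball x0 r) g) + ereal (t + 2 * A ^ 2 * N)" by simp
    also have "\<dots> \<le> M_rho M \<rho> g y + ereal (t + 2 * A ^ 2 * N)"
      using avg_le_M_rho[OF r, of y g] xy by (intro add_right_mono) simp
    finally show ?thesis .
  next
    case False
    show ?thesis
    proof (cases "4 * s < \<rho> z")
      case True
      have d: "dist z y < 4 * s"
        using xy x s(1) False dist_triangle[of z y x] dist_triangle[of x y x0] by (simp add: dist_commute)
      have "\<bar>avg M (ball z s) g - avg M (ball z (4 * s)) g\<bar> \<le> A ^ 2 * (2 * N)"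
        by (rule avg_diff_le_mean_oscillation[OF g mean_oscillation_le_of_BMO[OF g le N]])
           (use s doubling_power[of s z 2] in auto)
      then have "avg M (ball z s) g \<le> avg M (ball z (4 * s)) g + (t + 2 * A ^ 2 * N)"
        using T(2) by linarith
      then have "ereal (avg M (ball z s) g) \<le> ereal (avg M (ball z (4 * s)) g) + ereal (t + 2 * A ^ 2 * N)" by simp
      also have "\<dots> \<le> M_rho M \<rho> g y + ereal (t + 2 * A ^ 2 * N)"
        using avg_le_M_rho[OF _ True d, of g] s by (intro add_right_mono) simp
      finally show ?thesis .
    next
      case False
      have "\<bar>avg M (ball z s) g\<bar> \<le> A ^ 2 * N"
        by (rule abs_avg_le_of_D_superset[OF g le N]) (use s False in auto)
      moreover have "A * N \<le> A ^ 2 * N"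
        using A_ge_1 N by (intro mult_right_mono) (auto simp: power2_eq_square)
      ultimately have "avg M (ball z s) g \<le> - (A * N) + (t + 2 * A ^ 2 * N)"
        using T(2) by linarith
      then have "ereal (avg M (ball z s) g) \<le> ereal (- (A * N)) + ereal (t + 2 * A ^ 2 * N)" by simp
      also have "\<dots> \<le> M_rho M \<rho> g y + ereal (t + 2 * A ^ 2 * N)"
        by (intro add_right_mono M_rho_ge[OF g le N])
      finally show ?thesis .
    qed
  qed
qed

text \<open>
  Averages over balls of radius at most \<open>r\<close> are again controlled by the excess. A larger ball that is
  outside \<open>D_balls \<rho>\<close> has its centre near \<open>x0\<close> on the scale of \<open>\<rho>\<close>, so a bounded enlargement of it belongs to
  \<open>D_balls \<rho>\<close>.
\<close>

lemma M_rho_le_on_large_ball: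
  assumes g: "g \<in> L1_loc M" and le: "BMO_norm M \<rho> g \<le> ennreal N" and N: "0 \<le> N"
    and r: "\<rho> x0 \<le> r" and x: "x \<in> ball x0 r"
    and T: "upper_excess g x0 r x = ennreal t" "0 \<le> t"
  shows "M_rho M \<rho> g x \<le> ereal (t + A ^ rho_steps * N)"
proof (rule M_rho_leI)
  fix z s assume s: "0 < s" "s < \<rho> z" and xz: "dist z x < s"
  have r0: "0 < r" using r rho_pos[of x0] by simp
  show "ereal (avg M (ball z s) g) \<le> ereal (t + A ^ rho_steps * N)"
  proof (cases "s \<le> r")
    case True
    then have "ennreal (avg M (ball z s) g - avg M (ball x0 r) g) \<le> ennreal t"
      using avg_le_upper_excess[OF s(1) True xz, of g x0] T by simp
    then have "avg M (ball z s) g \<le> avg M (ball x0 r) g + t"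
      using T(2) by (simp add: ennreal_le_iff)
    moreover have "\<bar>avg M (ball x0 r) g\<bar> \<le> A ^ 0 * N"
      by (rule abs_avg_le_of_D_superset[OF g le N r0]) (use r in simp)
    moreover have "N \<le> A ^ rho_steps * N" using A_power_ge_1[of rho_steps] N mult_right_mono[of 1 "A ^ rho_steps" N] by simp
    ultimately show ?thesis by simp
  next
    case False
    have "dist x0 z \<le> 2 * \<rho> z"
      using False s x xz dist_triangle[of x0 z x] by (simp add: dist_commute)
    then have "\<rho> z \<le> 2 ^ rho_steps * \<rho> x0" by (rule rho_le_nearby)
    also have "\<dots> \<le> 2 ^ rho_steps * s" using False r by simp
    finally have "\<bar>avg M (ball z s) g\<bar> \<le> A ^ rho_steps * N"
      by (rule abs_avg_le_of_D_superset[OF g le N s(1)])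
    then show ?thesis using T(2) by simp
  qed
qed


lemma nn_avg_le_of_upper_excess:
  assumes g: "g \<in> L1_loc M" and osc: "mean_oscillation_le g N" and N: "0 < N" and r: "0 < r"
    and c: "0 \<le> c" and u: "AE y in M. y \<in> ball x r \<longrightarrow> u y \<le> upper_excess g x r y + ennreal c"
  shows "nn_avg M (ball x r) u \<le> ennreal (2 * JN_const * N + c)"
proof -
  let ?B = "ball x r"
  have K: "0 \<le> 2 * JN_const * N" using A_ge_1 N by (simp add: JN_const_def)
  have "(\<integral>\<^sup>+y\<in>?B. u y \<partial>M) \<le> (\<integral>\<^sup>+y. upper_excess g x r y * indicator ?B y + ennreal c * indicator ?B y \<partial>M)"
    by (rule nn_integral_mono_AE) (use u in \<open>auto elim!: eventually_mono simp: indicator_def\<close>)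
  also have "\<dots> = (\<integral>\<^sup>+y\<in>?B. upper_excess g x r y \<partial>M) + ennreal c * emeasure M ?B"
    by (subst nn_integral_add) (auto simp: nn_integral_cmult_indicator)
  also have "\<dots> \<le> ennreal (2 * JN_const * N) * emeasure M ?B + ennreal c * emeasure M ?B"
    by (intro add_right_mono nn_integral_upper_excess_le g osc N r)
  also have "\<dots> = ennreal (2 * JN_const * N + c) * emeasure M ?B"
    using K c by (simp add: distrib_right)
  finally have "nn_avg M ?B u \<le> ennreal (2 * JN_const * N + c) * emeasure M ?B / emeasure M ?B"
    unfolding nn_avg_def by (rule divide_right_mono_ennreal)
  also have "\<dots> = ennreal (2 * JN_const * N + c)"
    using emeasure_ball_pos[OF r, of x] emeasure_ball_finite[OF r, of x]
    by (subst mult_divide_eq_ennreal) auto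
  finally show ?thesis .
qed

definition BLO_const :: real where "BLO_const = 8 * JN_const + 2 * A ^ 2 + A ^ rho_steps + A + 3"

lemma BLO_of_representation:
  assumes f[measurable]: "f \<in> borel_measurable M"
    and g: "g \<in> L1_loc M" and le: "BMO_norm M \<rho> g \<le> ennreal N" and N: "0 < N"
    and h[measurable]: "h \<in> borel_measurable M" and hH: "Linf_norm M h \<le> ennreal H" and H: "0 \<le> H"
    and eq: "AE x in M. ereal (f x) = M_rho M \<rho> g x + ereal (h x)"
  shows "f \<in> L1_loc M" and "BLO_norm M \<rho> f \<le> ennreal (BLO_const * (N + H))"
proof -
  have N0: "0 \<le> N" using N by simp
  note osc = mean_oscillation_le_of_BMO[OF g le N0]
  have K: "0 \<le> JN_const" using A_ge_1 by (simp add: JN_const_def)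
  have AEh: "AE x in M. ereal (f x) = M_rho M \<rho> g x + ereal (h x) \<and> \<bar>h x\<bar> \<le> H"
    using eq esssup_AE[of "\<lambda>x. ennreal \<bar>h x\<bar>" M]
  proof eventually_elim
    case (elim x)
    then have "ennreal \<bar>h x\<bar> \<le> ennreal H" using hH by (simp add: Linf_norm_def)
    then show ?case using elim H by simp
  qed
  \<comment> \<open>\<open>c1\<close> and \<open>c2\<close> are what remains besides the excess on balls outside and inside \<open>D_balls \<rho>\<close>;
    \<open>h\<close> enters twice in \<open>c1\<close>, once at each of the two points that are compared.\<close>
  define c1 where "c1 = 2 * A ^ 2 * N + 2 * H"
  define c2 where "c2 = (A ^ rho_steps + A) * N + H"
  have c: "0 \<le> c1" "0 \<le> c2" using N H A_ge_1 by (auto simp: c1_def c2_def)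
  have small: "nn_avg M (ball x0 r) (\<lambda>y. e2ennreal (ereal (f y) - ess_inf_on M (ball x0 r) f))
      \<le> ennreal (2 * JN_const * (2 * N) + c1)" if r: "0 < r" "r < \<rho> x0" for x0 r
  proof (rule nn_avg_le_of_upper_excess[OF g osc])
    show "AE x in M. x \<in> ball x0 r \<longrightarrow>
        e2ennreal (ereal (f x) - ess_inf_on M (ball x0 r) f) \<le> upper_excess g x0 r x + ennreal c1"
      using AEh
    proof (eventually_elim, intro impI)
      fix x assume x: "ereal (f x) = M_rho M \<rho> g x + ereal (h x) \<and> \<bar>h x\<bar> \<le> H" "x \<in> ball x0 r"
      show "e2ennreal (ereal (f x) - ess_inf_on M (ball x0 r) f) \<le> upper_excess g x0 r x + ennreal c1"
      proof (cases "upper_excess g x0 r x")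
        case (real t)
        have "AE y in M. y \<in> ball x0 r \<longrightarrow> f x - (t + c1) \<le> f y"
          using AEh
        proof (eventually_elim, intro impI)
          fix y assume y: "ereal (f y) = M_rho M \<rho> g y + ereal (h y) \<and> \<bar>h y\<bar> \<le> H" "y \<in> ball x0 r"
          have "M_rho M \<rho> g x \<le> M_rho M \<rho> g y + ereal (t + 2 * A ^ 2 * N)"
            by (rule M_rho_le_on_small_ball[OF g le N0 r x(2) y(2)]) (use real in auto)
          then show "f x - (t + c1) \<le> f y"
            using x(1) y(1) by (cases "M_rho M \<rho> g x"; cases "M_rho M \<rho> g y") (auto simp: c1_def)
        qed
        then have "AE y in restrict_space M (ball x0 r). - ereal (f y) \<le> - ereal (f x - (t + c1))"
          by (subst AE_restrict_space_iff) auto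
        then have "esssup (restrict_space M (ball x0 r)) (\<lambda>y. - ereal (f y)) \<le> - ereal (f x - (t + c1))"
          by (rule esssup_I[rotated]) (auto intro!: measurable_restrict_space1)
        then have "ereal (f x - (t + c1)) \<le> ess_inf_on M (ball x0 r) f"
          unfolding ess_inf_on_def using ereal_minus_le_minus by (metis ereal_uminus_uminus)
        then have "ereal (f x) - ess_inf_on M (ball x0 r) f \<le> ereal (t + c1)"
          by (cases "ess_inf_on M (ball x0 r) f") auto
        then have "e2ennreal (ereal (f x) - ess_inf_on M (ball x0 r) f) \<le> e2ennreal (ereal (t + c1))"
          by (rule e2ennreal_mono)
        also have "\<dots> = upper_excess g x0 r x + ennreal c1"
          using real c by (simp add: e2ennreal_ereal)
        finally show ?thesis .
      qed simp
    qed
  qed (use N r c in auto)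
  have large: "nn_avg M (ball x0 r) (\<lambda>y. ennreal \<bar>f y\<bar>) \<le> ennreal (2 * JN_const * (2 * N) + c2)"
    if r: "\<rho> x0 \<le> r" for x0 r
  proof (rule nn_avg_le_of_upper_excess[OF g osc])
    show "0 < r" using r rho_pos[of x0] by simp
    show "AE x in M. x \<in> ball x0 r \<longrightarrow> ennreal \<bar>f x\<bar> \<le> upper_excess g x0 r x + ennreal c2"
      using AEh
    proof (eventually_elim, intro impI)
      fix x assume x: "ereal (f x) = M_rho M \<rho> g x + ereal (h x) \<and> \<bar>h x\<bar> \<le> H" "x \<in> ball x0 r"
      show "ennreal \<bar>f x\<bar> \<le> upper_excess g x0 r x + ennreal c2"
      proof (cases "upper_excess g x0 r x")
        case (real t)
        have "M_rho M \<rho> g x \<le> ereal (t + A ^ rho_steps * N)"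
          by (rule M_rho_le_on_large_ball[OF g le N0 r x(2)]) (use real in auto)
        moreover have "ereal (- (A * N)) \<le> M_rho M \<rho> g x" by (rule M_rho_ge[OF g le N0])
        moreover have "0 \<le> A * N" "0 \<le> A ^ rho_steps * N" using A_ge_1 N by auto
        ultimately have "\<bar>f x\<bar> \<le> t + c2"
          using x(1) real(1) by (cases "M_rho M \<rho> g x") (auto simp: c2_def distrib_right abs_le_iff)
        then have "ennreal \<bar>f x\<bar> \<le> ennreal (t + c2)" by (rule ennreal_leI)
        then show ?thesis using real c by simp
      qed simp
    qed
  qed (use N c in auto)
  have "set_integrable M (ball x r) f" if "0 < r" for x r
  proof -
    define R where "R = max r (\<rho> x)"
    have R: "\<rho> x \<le> R" "0 < R" "ball x r \<subseteq> ball x R" using that by (auto simp: R_def)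
    have "nn_avg M (ball x R) (\<lambda>y. ennreal \<bar>f y\<bar>) < \<infinity>"
      using large[OF R(1)] by (rule le_less_trans) simp
    then have "(\<integral>\<^sup>+y\<in>ball x R. ennreal \<bar>f y\<bar> \<partial>M) < \<infinity>"
      using emeasure_ball_finite[OF R(2), of x]
      by (auto simp: nn_avg_def ennreal_divide_eq_top_iff top.not_eq_extremum[symmetric])
    moreover have "(\<integral>\<^sup>+y. ennreal (norm (indicator (ball x R) y *\<^sub>R f y)) \<partial>M) = (\<integral>\<^sup>+y\<in>ball x R. ennreal \<bar>f y\<bar> \<partial>M)"
      by (intro nn_integral_cong) (auto simp: indicator_def)
    moreover have "(\<lambda>y. indicator (ball x R) y *\<^sub>R f y) \<in> borel_measurable M" by measurable
    ultimately have "set_integrable M (ball x R) f"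
      unfolding set_integrable_def by (intro integrableI_bounded) auto
    then show ?thesis by (rule set_integrable_subset) (use R in auto)
  qed
  then show "f \<in> L1_loc M" by (auto simp: L1_loc_def balls_def)
  have "BLO_norm M \<rho> f \<le> ennreal (2 * JN_const * (2 * N) + c1) + ennreal (2 * JN_const * (2 * N) + c2)"
    unfolding BLO_norm_def
    by (intro add_mono SUP_least) (use small large in \<open>fastforce simp: balls_def D_balls_def not_le\<close>)+
  also have "\<dots> = ennreal (2 * JN_const * (2 * N) + c1 + (2 * JN_const * (2 * N) + c2))"
    using K N c by (subst ennreal_plus) auto
  also have "\<dots> \<le> ennreal (BLO_const * (N + H))"
  proof (rule ennreal_leI)
    have "0 \<le> (8 * JN_const + 2 * A ^ 2 + A ^ rho_steps + A) * H" "0 \<le> 3 * N" using K A_ge_1 N H by auto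
    then show "2 * JN_const * (2 * N) + c1 + (2 * JN_const * (2 * N) + c2) \<le> BLO_const * (N + H)"
      by (simp add: BLO_const_def c1_def c2_def algebra_simps)
  qed
  finally show "BLO_norm M \<rho> f \<le> ennreal (BLO_const * (N + H))" .
qed

section \<open>The two inequalities between the norms\<close>

lemma BLO_const_ge: "4 \<le> BLO_const"
  using A_ge_1 A_power_ge_1[of rho_steps] A_power_ge_1[of 2]
  by (simp add: BLO_const_def JN_const_def add_increasing)

text \<open>
  The decay estimate requires a positive bound for the mean oscillation, whereas the norm of \<open>g\<close> may
  be 0. So it is applied with \<open>n + e\<close> for \<open>e > 0\<close>, and then \<open>e\<close> tends to 0.
\<close>

lemma BLO_norm_le_of_representation:
  assumes f: "f \<in> borel_measurable M" and gh: "(g, h) \<in> representations M \<rho> f"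
  shows "f \<in> L1_loc M" and "BLO_norm M \<rho> f \<le> ennreal BLO_const * (BMO_norm M \<rho> g + Linf_norm M h)"
proof -
  obtain n where n: "BMO_norm M \<rho> g = ennreal n" "0 \<le> n"
    using gh by (cases "BMO_norm M \<rho> g") (auto simp: representations_def BMO_def)
  obtain H where H: "Linf_norm M h = ennreal H" "0 \<le> H"
    using gh by (cases "Linf_norm M h") (auto simp: representations_def Linf_def)
  have *: "f \<in> L1_loc M \<and> BLO_norm M \<rho> f \<le> ennreal (BLO_const * (n + e + H))" if "0 < e" for e
    using BLO_of_representation[OF f _ _ _ _ _ H(2), of g "n + e" h] gh n H that
    by (auto simp: representations_def BMO_def Linf_def simp del: ennreal_plus intro!: ennreal_leI)
  then show "f \<in> L1_loc M" using zero_less_one by blast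
  have "BLO_norm M \<rho> f \<le> ennreal (BLO_const * (n + H))"
  proof (rule LIMSEQ_le_const[where X = "\<lambda>i. ennreal (BLO_const * (n + 1 / Suc i + H))"])
    have "(\<lambda>i. BLO_const * (n + 1 / Suc i + H)) \<longlonglongrightarrow> BLO_const * (n + 0 + H)"
      by (intro tendsto_intros LIMSEQ_Suc lim_1_over_n)
    then show "(\<lambda>i. ennreal (BLO_const * (n + 1 / Suc i + H))) \<longlonglongrightarrow> ennreal (BLO_const * (n + H))"
      by (intro tendsto_ennrealI) simp
  qed (use * in auto)
  then show "BLO_norm M \<rho> f \<le> ennreal BLO_const * (BMO_norm M \<rho> g + Linf_norm M h)"
    using n H BLO_const_ge by (simp add: ennreal_mult)
qed

lemma exists_representation:
  assumes "f \<in> BLO M \<rho>"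
  shows "\<exists>g h. (g, h) \<in> representations M \<rho> f \<and> BMO_norm M \<rho> g + Linf_norm M h \<le> ennreal BLO_const * BLO_norm M \<rho> f"
proof -
  obtain N where N: "BLO_norm M \<rho> f = ennreal N" "0 \<le> N"
    using assms by (cases "BLO_norm M \<rho> f") (auto simp: BLO_def)
  have f: "f \<in> L1_loc M" using assms by (simp add: BLO_def)
  have "ennreal (4 * N) \<le> ennreal (BLO_const * N)"
    using BLO_const_ge N by (intro ennreal_leI mult_right_mono) auto
  also have "\<dots> = ennreal BLO_const * BLO_norm M \<rho> f" using N BLO_const_ge by (simp add: ennreal_mult)
  finally show ?thesis
    using BLO_representation[OF f eq_refl[OF N(1)] N(2)] order_trans by blast
qed

lemma BLO_iff_representation:
  assumes f: "f \<in> borel_measurable M"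
  shows "f \<in> BLO M \<rho> \<longleftrightarrow> (\<exists>g h. (g, h) \<in> representations M \<rho> f)"
proof
  assume "\<exists>g h. (g, h) \<in> representations M \<rho> f"
  then obtain g h where gh: "(g, h) \<in> representations M \<rho> f" by blast
  then have "ennreal BLO_const * (BMO_norm M \<rho> g + Linf_norm M h) < \<infinity>"
    by (auto simp: representations_def BMO_def Linf_def ennreal_mult_less_top)
  then show "f \<in> BLO M \<rho>"
    using BLO_norm_le_of_representation[OF f gh] by (auto simp: BLO_def)
qed (use exists_representation in blast)

lemma BLO_norm_equivalent:
  assumes "f \<in> BLO M \<rho>"
  shows "ennreal (inverse BLO_const) * BLO_norm M \<rho> f
      \<le> (INF (g, h) \<in> representations M \<rho> f. BMO_norm M \<rho> g + Linf_norm M h)"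
    and "(INF (g, h) \<in> representations M \<rho> f. BMO_norm M \<rho> g + Linf_norm M h)
      \<le> ennreal BLO_const * BLO_norm M \<rho> f"
proof -
  have f: "f \<in> borel_measurable M" using assms by (auto simp: BLO_def intro: L1_loc_measurable)
  have inv: "ennreal (inverse BLO_const) * ennreal BLO_const = 1"
    using BLO_const_ge by (subst ennreal_mult[symmetric]) auto
  show "ennreal (inverse BLO_const) * BLO_norm M \<rho> f
      \<le> (INF (g, h) \<in> representations M \<rho> f. BMO_norm M \<rho> g + Linf_norm M h)"
  proof (rule INF_greatest, clarify)
    fix g h assume "(g, h) \<in> representations M \<rho> f"
    then have "ennreal (inverse BLO_const) * BLO_norm M \<rho> f
        \<le> ennreal (inverse BLO_const) * (ennreal BLO_const * (BMO_norm M \<rho> g + Linf_norm M h))"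
      by (intro mult_left_mono BLO_norm_le_of_representation f) auto
    then show "ennreal (inverse BLO_const) * BLO_norm M \<rho> f \<le> BMO_norm M \<rho> g + Linf_norm M h"
      by (simp add: inv mult.assoc[symmetric])
  qed
  obtain g h where gh: "(g, h) \<in> representations M \<rho> f"
    "BMO_norm M \<rho> g + Linf_norm M h \<le> ennreal BLO_const * BLO_norm M \<rho> f"
    using exists_representation[OF assms] by blast
  then show "(INF (g, h) \<in> representations M \<rho> f. BMO_norm M \<rho> g + Linf_norm M h)
      \<le> ennreal BLO_const * BLO_norm M \<rho> f"
    by (intro INF_lower2[OF gh(1)]) simp
qed

end

lemma admissible_doubling_measure_of_RD_space:
  assumes "RD_space M" and "admissible \<rho>"
  obtains A C0 k0 where "admissible_doubling_measure M A \<rho> C0 k0"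
proof -
  obtain A where A: "1 \<le> A" "\<And>x r. 0 < r \<Longrightarrow> measure M (ball x (2 * r)) \<le> A * measure M (ball x r)"
    using assms(1) unfolding RD_space_def by blast
  obtain C0 k0 where C: "0 < C0" "0 < k0"
    "\<And>x y. 1 / \<rho> x \<le> C0 * (1 / \<rho> y) * (1 + dist x y / \<rho> y) powr k0"
    using assms(2) unfolding admissible_def by blast
  have "admissible_doubling_measure M A \<rho> C0 k0"
    using assms A C
    by unfold_locales (auto simp: RD_space_def regular_borel_measure_def admissible_def)
  then show ?thesis by (rule that)
qed

theorem theorem4p2:
  fixes M :: "'a::metric_space measure" and \<rho> :: "'a \<Rightarrow> real"
  assumes "RD_space M" and "admissible \<rho>"
  shows "(\<forall>f \<in> borel_measurable M.
            f \<in> BLO M \<rho> \<longleftrightarrow>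
            (\<exists>h \<in> Linf M. \<exists>g \<in> BMO M \<rho>. AE x in M. ereal (f x) = M_rho M \<rho> g x + ereal (h x))) \<and>
         (\<exists>C::real. C \<ge> 1 \<and> (\<forall>f \<in> BLO M \<rho>.
            ennreal (inverse C) * BLO_norm M \<rho> f
              \<le> (INF (g, h) \<in> representations M \<rho> f. BMO_norm M \<rho> g + Linf_norm M h) \<and>
            (INF (g, h) \<in> representations M \<rho> f. BMO_norm M \<rho> g + Linf_norm M h)
              \<le> ennreal C * BLO_norm M \<rho> f))"
proof -
  obtain A C0 k0 where "admissible_doubling_measure M A \<rho> C0 k0"
    using admissible_doubling_measure_of_RD_space[OF assms] .
  then interpret admissible_doubling_measure M A \<rho> C0 k0 .
  have "1 \<le> BLO_const" using BLO_const_ge by simp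
  then show ?thesis
    using BLO_iff_representation BLO_norm_equivalent
    by (intro conjI exI[of _ BLO_const]) (auto simp: representations_def)
qed

end
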